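(* The characteristic polynomial and the minimal polynomial of $T\in I(Q)$ determine the conjugacy class of $T$ in $I(Q)$. That is, if $T,T'\in I(Q)$ have the same characteristic polynomial and the same minimal polynomial, then $T$ and $T'$ are conjugate in $I(Q)$.
   Context: $n$ is a positive integer, $\mathbb{V}$ is a real vector space of dimension $n+1$ with a quadratic form $Q$ of signature $(1,n)$ (one positive, $n$ negative), and $O(Q)$ is its full isometry group. The hyperboloid $\{v\in\mathbb{V}: Q(v)=1\}$ has two components; one of them is the model of the hyperbolic space $\mathbb{H}^n$. $I(Q)$ is the subgroup of $O(Q)$ preserving this component, and it is identified with the full isometry group $I(\mathbb{H}^n)$. The characteristic and minimal polynomials are those of $T$ as a linear operator on $\mathbb{V}$. *)

theory Defs
  imports "HOL-Analysis.Analysis" "Jordan_Normal_Form.Char_Poly"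
begin

section \<open>Quadratic forms and their isometry groups\<close>

definition polar_form :: "('v::real_vector \<Rightarrow> real) \<Rightarrow> 'v \<Rightarrow> 'v \<Rightarrow> real" where
  "polar_form Q x y = (Q (x + y) - Q x - Q y) / 2"

definition quadratic_form :: "('v::real_vector \<Rightarrow> real) \<Rightarrow> bool" where
  "quadratic_form Q \<longleftrightarrow> bilinear (polar_form Q) \<and> (\<forall>c x. Q (c *\<^sub>R x) = c\<^sup>2 * Q x)"

text \<open>Some (equivalently, by Sylvester's law of inertia, every) orthogonal basis consists of
  \<open>p\<close> vectors on which \<open>Q\<close> is positive and \<open>q\<close> vectors on which \<open>Q\<close> is negative. In particular
  \<open>Q\<close> is nondegenerate.\<close>
definition has_signature :: "('v::real_vector \<Rightarrow> real) \<Rightarrow> nat \<Rightarrow> nat \<Rightarrow> bool" where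
  "has_signature Q p q \<longleftrightarrow>
     (\<exists>P N. finite P \<and> finite N \<and> P \<inter> N = {} \<and> card P = p \<and> card N = q \<and>
        independent (P \<union> N) \<and> span (P \<union> N) = UNIV \<and>
        (\<forall>x\<in>P \<union> N. \<forall>y\<in>P \<union> N. x \<noteq> y \<longrightarrow> polar_form Q x y = 0) \<and>
        (\<forall>x\<in>P. Q x > 0) \<and> (\<forall>x\<in>N. Q x < 0))"

definition orthogonal_group :: "('v::real_vector \<Rightarrow> real) \<Rightarrow> ('v \<Rightarrow> 'v) set" where
  "orthogonal_group Q = {T. linear T \<and> bij T \<and> (\<forall>v. Q (T v) = Q v)}"

definition hyperboloid :: "('v::real_vector \<Rightarrow> real) \<Rightarrow> 'v set" where
  "hyperboloid Q = {v. Q v = 1}"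

text \<open>\<open>H\<close> is meant to be the connected component of the hyperboloid chosen as the model of
  hyperbolic space.\<close>
definition hyperbolic_isometries ::
  "('v::real_vector \<Rightarrow> real) \<Rightarrow> 'v set \<Rightarrow> ('v \<Rightarrow> 'v) set" where
  "hyperbolic_isometries Q H = {T \<in> orthogonal_group Q. T ` H = H}"

definition conjugate_in :: "('v \<Rightarrow> 'v) set \<Rightarrow> ('v \<Rightarrow> 'v) \<Rightarrow> ('v \<Rightarrow> 'v) \<Rightarrow> bool" where
  "conjugate_in G S T \<longleftrightarrow> (\<exists>g\<in>G. T = g \<circ> S \<circ> inv_into UNIV g)"


section \<open>Characteristic polynomial of a linear operator\<close>

definition list_basis :: "'v::real_vector list \<Rightarrow> bool" where
  "list_basis bs \<longleftrightarrow> distinct bs \<and> independent (set bs) \<and> span (set bs) = UNIV"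

definition matrix_wrt :: "'v::real_vector list \<Rightarrow> 'v list \<Rightarrow> ('v \<Rightarrow> 'v) \<Rightarrow> real mat" where
  "matrix_wrt cs bs T =
     mat (length cs) (length bs) (\<lambda>(i, j). representation (set cs) (T (bs ! j)) (cs ! i))"

text \<open>The choice of the basis is immaterial, see \<open>operator_char_poly_eq\<close>.\<close>
definition operator_char_poly :: "('v::real_vector \<Rightarrow> 'v) \<Rightarrow> real poly" where
  "operator_char_poly T = (let bs = (SOME bs. list_basis bs) in char_poly (matrix_wrt bs bs T))"

lemma list_basis_exists: "\<exists>bs :: 'v::euclidean_space list. list_basis bs"
proof -
  obtain bs :: "'v list" where "set bs = Basis" "distinct bs"
    using finite_distinct_list[OF finite_Basis] by blast
  then show ?thesis
    unfolding list_basis_def by (intro exI[of _ bs]) (simp add: independent_Basis)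
qed

lemma list_basis_expansion:
  assumes "list_basis bs"
  shows "(\<Sum>i<length bs. representation (set bs) v (bs ! i) *\<^sub>R bs ! i) = v"
proof -
  have "(\<Sum>i<length bs. representation (set bs) v (bs ! i) *\<^sub>R bs ! i)
      = (\<Sum>b\<in>set bs. representation (set bs) v b *\<^sub>R b)"
    using assms
    by (intro sum.reindex_bij_betw[of "(!) bs" _ _ "\<lambda>b. representation (set bs) v b *\<^sub>R b"])
       (auto simp: list_basis_def intro: bij_betw_nth)
  also have "\<dots> = v"
    using assms by (intro real_vector.sum_representation_eq) (auto simp: list_basis_def)
  finally show ?thesis .
qed

lemma matrix_wrt_comp:
  assumes bs: "list_basis bs" and cs: "list_basis cs" and ds: "list_basis ds"
    and S: "linear S"
  shows "matrix_wrt ds cs S * matrix_wrt cs bs T = matrix_wrt ds bs (S \<circ> T)"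
proof (rule eq_matI)
  fix i j
  assume "i < dim_row (matrix_wrt ds bs (S \<circ> T))" "j < dim_col (matrix_wrt ds bs (S \<circ> T))"
  then have i: "i < length ds" and j: "j < length bs" by (simp_all add: matrix_wrt_def)
  define v where "v = T (bs ! j)"
  have ind: "independent (set ds)" and sp: "\<And>x. x \<in> span (set ds)"
    using ds by (auto simp: list_basis_def)
  have "representation (set ds) (S v) (ds ! i)
      = representation (set ds) (S (\<Sum>k<length cs. representation (set cs) v (cs ! k) *\<^sub>R cs ! k)) (ds ! i)"
    using list_basis_expansion[OF cs, of v] by simp
  also have "\<dots> = representation (set ds)
       (\<Sum>k<length cs. representation (set cs) v (cs ! k) *\<^sub>R S (cs ! k)) (ds ! i)"
    using S by (simp add: linear_sum linear_cmul)
  also have "\<dots> = (\<Sum>k<length cs.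
      representation (set cs) v (cs ! k) * representation (set ds) (S (cs ! k)) (ds ! i))"
    by (simp add: real_vector.representation_sum[OF ind] real_vector.representation_scale[OF ind] sp)
  finally show "(matrix_wrt ds cs S * matrix_wrt cs bs T) $$ (i, j)
      = matrix_wrt ds bs (S \<circ> T) $$ (i, j)"
    using i j by (simp add: matrix_wrt_def scalar_prod_def v_def mult.commute atLeast0LessThan)
qed (simp_all add: matrix_wrt_def)

lemma matrix_wrt_id:
  assumes "list_basis bs"
  shows "matrix_wrt bs bs id = 1\<^sub>m (length bs)"
  using assms
  by (intro eq_matI)
     (auto simp: matrix_wrt_def list_basis_def real_vector.representation_basis nth_eq_iff_index_eq)

lemma char_poly_matrix_wrt_independent:
  assumes bs: "list_basis bs" and cs: "list_basis cs" and T: "linear T"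
  shows "char_poly (matrix_wrt bs bs T) = char_poly (matrix_wrt cs cs T)"
proof -
  have len: "length bs = length cs"
    using bs cs unfolding list_basis_def
    by (metis distinct_card dim_eq_card_independent dim_span)
  have id: "linear (id :: 'a \<Rightarrow> 'a)" by (rule linear_id)
  have "similar_mat_wit (matrix_wrt bs bs T) (matrix_wrt cs cs T) (matrix_wrt bs cs id)
      (matrix_wrt cs bs id)"
    unfolding similar_mat_wit_def Let_def
    by (auto simp: matrix_wrt_comp[OF _ _ _ id] matrix_wrt_comp[OF _ _ _ T] bs cs matrix_wrt_id len)
       (auto simp: matrix_wrt_def len)
  then show ?thesis
    by (intro char_poly_similar) (auto simp: similar_mat_def)
qed

lemma operator_char_poly_eq:
  assumes "list_basis bs" "linear T"
  shows "operator_char_poly T = char_poly (matrix_wrt bs bs T)"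
  unfolding operator_char_poly_def Let_def
  by (intro char_poly_matrix_wrt_independent assms someI[of list_basis bs])


section \<open>Minimal polynomial of a linear operator\<close>

definition poly_operator :: "real poly \<Rightarrow> ('v::real_vector \<Rightarrow> 'v) \<Rightarrow> 'v \<Rightarrow> 'v" where
  "poly_operator p T v = (\<Sum>i\<le>degree p. coeff p i *\<^sub>R (T ^^ i) v)"

definition is_min_poly :: "('v::real_vector \<Rightarrow> 'v) \<Rightarrow> real poly \<Rightarrow> bool" where
  "is_min_poly T p \<longleftrightarrow> monic p \<and> (\<forall>v. poly_operator p T v = 0) \<and>
     (\<forall>q. monic q \<and> (\<forall>v. poly_operator q T v = 0) \<longrightarrow> degree p \<le> degree q)"

definition operator_min_poly :: "('v::real_vector \<Rightarrow> 'v) \<Rightarrow> real poly" where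
  "operator_min_poly T = (THE p. is_min_poly T p)"

lemma poly_operator_bound:
  assumes "degree p \<le> N"
  shows "poly_operator p T v = (\<Sum>i\<le>N. coeff p i *\<^sub>R (T ^^ i) v)"
  unfolding poly_operator_def using assms
  by (intro sum.mono_neutral_left) (auto simp: coeff_eq_0)

lemma poly_operator_0 [simp]: "poly_operator 0 T v = 0"
  by (simp add: poly_operator_def)

lemma poly_operator_add: "poly_operator (p + q) T v = poly_operator p T v + poly_operator q T v"
proof -
  let ?N = "max (degree p) (degree q)"
  show ?thesis
    by (simp add: poly_operator_bound[of _ ?N] degree_add_le scaleR_left_distrib sum.distrib)
qed

lemma poly_operator_smult: "poly_operator (Polynomial.smult c p) T v = c *\<^sub>R poly_operator p T v"
  by (simp add: poly_operator_bound[of _ "degree p"] scaleR_right.sum)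

lemma poly_operator_diff: "poly_operator (p - q) T v = poly_operator p T v - poly_operator q T v"
  using poly_operator_add[of "p - q" q T v] by simp

lemma poly_operator_pCons: "poly_operator (pCons a p) T v = a *\<^sub>R v + poly_operator p T (T v)"
  by (subst poly_operator_bound[of _ "Suc (degree p)"], simp add: degree_pCons_le)
     (subst sum.atMost_Suc_shift, simp add: poly_operator_def funpow_swap1)

lemma linear_funpow:
  fixes T :: "'v::real_vector \<Rightarrow> 'v"
  assumes "linear T"
  shows "linear (T ^^ i)"
proof (induction i)
  case (Suc i)
  then show ?case using linear_compose[OF Suc assms] by (simp add: o_def)
qed (simp add: linear_id[unfolded id_def])

lemma linear_poly_operator: "linear T \<Longrightarrow> linear (poly_operator p T)"
  unfolding poly_operator_def[abs_def]
  by (intro linear_compose_sum ballI linear_compose_scale_right linear_funpow)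

lemma poly_operator_commute:
  "linear T \<Longrightarrow> poly_operator p T (T v) = T (poly_operator p T v)"
  by (simp add: poly_operator_def linear_sum linear_cmul funpow_swap1)

lemma poly_operator_mult:
  assumes "linear T"
  shows "poly_operator (p * q) T v = poly_operator p T (poly_operator q T v)"
proof (induction p arbitrary: v)
  case (pCons a p)
  then show ?case
    by (simp add: poly_operator_add poly_operator_smult poly_operator_pCons
        poly_operator_commute[OF assms])
qed simp

lemma vector_annihilator_exists:
  fixes T :: "'v::euclidean_space \<Rightarrow> 'v"
  shows "\<exists>p. p \<noteq> 0 \<and> poly_operator p T v = 0"
proof (cases "inj_on (\<lambda>i. (T ^^ i) v) {..DIM('v)}")
  case True
  let ?f = "\<lambda>i. (T ^^ i) v"
  have "card (?f ` {..DIM('v)}) > DIM('v)" using True by (simp add: card_image)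
  then have "dependent (?f ` {..DIM('v)})" by (intro dependent_biggerset) auto
  then obtain u where u: "\<exists>w\<in>?f ` {..DIM('v)}. u w \<noteq> 0"
    and s: "(\<Sum>w\<in>?f ` {..DIM('v)}. u w *\<^sub>R w) = 0"
    by (auto simp: real_vector.dependent_finite)
  define p where "p = (\<Sum>i\<le>DIM('v). monom (u (?f i)) i)"
  have c: "coeff p i = (if i \<le> DIM('v) then u (?f i) else 0)" for i
    by (simp add: p_def coeff_sum)
  have "degree p \<le> DIM('v)" by (rule degree_le) (simp add: c)
  then have "poly_operator p T v = (\<Sum>i\<le>DIM('v). u (?f i) *\<^sub>R ?f i)"
    by (simp add: poly_operator_bound c)
  also have "\<dots> = 0" using s True by (simp add: sum.reindex)
  finally have "poly_operator p T v = 0" .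
  moreover have "p \<noteq> 0"
  proof
    assume "p = 0"
    then have "u (?f i) = 0" if "i \<le> DIM('v)" for i using c[of i] that by simp
    then show False using u by auto
  qed
  ultimately show ?thesis by blast
next
  case False
  then obtain i j where ij: "i \<noteq> j" "(T ^^ i) v = (T ^^ j) v" by (auto simp: inj_on_def)
  let ?p = "monom 1 i - monom (1::real) j"
  have m: "poly_operator (monom 1 k) T v = (T ^^ k) v" for k
  proof -
    have "poly_operator (monom 1 k) T v = (\<Sum>i\<le>k. if i = k then (T ^^ k) v else 0)"
      unfolding poly_operator_def by (intro sum.cong) (auto simp: degree_monom_eq)
    then show ?thesis by simp
  qed
  have "coeff ?p i = 1" using ij by simp
  then have "?p \<noteq> 0" by (metis coeff_0 zero_neq_one)
  moreover have "poly_operator ?p T v = 0" using ij by (simp add: poly_operator_diff m)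
  ultimately show ?thesis by blast
qed

lemma operator_annihilator_exists:
  fixes T :: "'v::euclidean_space \<Rightarrow> 'v"
  assumes T: "linear T"
  shows "\<exists>p. monic p \<and> (\<forall>v. poly_operator p T v = 0)"
proof -
  have "\<exists>p. p \<noteq> 0 \<and> (\<forall>v\<in>B. poly_operator p T v = 0)" if "finite B" for B :: "'v set"
    using that
  proof (induction B)
    case (insert b B)
    then obtain p where p: "p \<noteq> 0" "\<forall>v\<in>B. poly_operator p T v = 0" by blast
    obtain q where q: "q \<noteq> 0" "poly_operator q T b = 0"
      using vector_annihilator_exists by blast
    have "poly_operator (q * p) T v = 0" if "v \<in> B" for v
      using that p by (simp add: poly_operator_mult[OF T] linear_0[OF linear_poly_operator[OF T]])
    moreover have "poly_operator (q * p) T b = 0"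
      using q by (subst mult.commute)
        (simp add: poly_operator_mult[OF T] linear_0[OF linear_poly_operator[OF T]])
    ultimately show ?case using p q by (intro exI[of _ "q * p"]) auto
  qed (auto intro: exI[of _ 1])
  from this[OF finite_Basis] obtain p where p: "p \<noteq> 0" "\<forall>v\<in>Basis. poly_operator p T v = 0"
    by blast
  have "poly_operator p T = (\<lambda>_. 0)"
    by (rule linear_eq_stdbasis[OF linear_poly_operator[OF T] linear_zero]) (use p in auto)
  then show ?thesis
    using p by (intro exI[of _ "Polynomial.smult (inverse (lead_coeff p)) p"])
      (simp add: poly_operator_smult)
qed

lemma is_min_poly_unique:
  assumes p: "is_min_poly T p" and q: "is_min_poly T q"
  shows "p = q"
proof (rule ccontr)
  assume "p \<noteq> q"
  have deg: "degree p = degree q" using p q by (auto simp: is_min_poly_def intro: antisym)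
  define r where "r = Polynomial.smult (inverse (lead_coeff (p - q))) (p - q)"
  have nz: "lead_coeff (p - q) \<noteq> 0" using \<open>p \<noteq> q\<close> by (metis leading_coeff_0_iff right_minus_eq)
  then have "monic r"
    unfolding r_def lead_coeff_smult by (rule left_inverse)
  moreover have "\<forall>v. poly_operator r T v = 0"
    using p q by (simp add: r_def poly_operator_smult poly_operator_diff is_min_poly_def)
  ultimately have "degree p \<le> degree r" using p by (auto simp: is_min_poly_def)
  also have "degree r = degree (p - q)"
    unfolding r_def degree_smult_eq using nz nonzero_imp_inverse_nonzero by metis
  finally have le: "degree p \<le> degree (p - q)" .
  moreover have "degree (p - q) \<le> degree p" using deg by (simp add: degree_diff_le)
  ultimately have "lead_coeff (p - q) = 0"
    using p q deg by (simp add: is_min_poly_def)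
  then show False using nz by contradiction
qed

lemma is_min_poly_operator_min_poly:
  fixes T :: "'v::euclidean_space \<Rightarrow> 'v"
  assumes "linear T"
  shows "is_min_poly T (operator_min_poly T)"
proof -
  let ?A = "\<lambda>p. monic p \<and> (\<forall>v. poly_operator p T v = 0)"
  obtain p where "?A p" "\<forall>q. ?A q \<longrightarrow> degree p \<le> degree q"
    using operator_annihilator_exists[OF assms] ex_has_least_nat[of ?A _ degree] by blast
  then have "is_min_poly T p" by (simp add: is_min_poly_def)
  then show ?thesis
    unfolding operator_min_poly_def by (rule theI) (blast intro: is_min_poly_unique \<open>is_min_poly T p\<close>)
qed

end

(*
  A maximal isometric isomorphism between invariant subspaces intertwining T and T' is built one
  block at a time. Brouwer's theorem on the ball of nonspacelike directions shows that T either
  fixes a timelike vector, or has a real eigenvalue l with l^2 <> 1 and then a hyperbolic plane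
  spanned by null eigenvectors for l and 1/l, or has a Jordan chain u, Su, S^2 u <> 0, S^3 u = 0 with
  S = T - 1, normalised by scaling and adding a multiple of S^2 u. The last two alternatives can be
  read off the minimal polynomial, so T and T' share the same starting block. It contains a timelike
  vector, so its orthogonal complement is negative definite. There the characteristic polynomials
  of T and T' agree, and a common complex root z yields vectors u with
  T^2 u = 2 Re z T u - |z|^2 u for both operators; the Gram matrix of u, T u depends only on z, so
  the isomorphism extends until it is defined everywhere. Replacing it by its negative, if
  necessary, makes it preserve H.
*)
theory Submission
  imports Defs
begin

section \<open>Lorentzian forms\<close>

text \<open>Signature (1,n) is recorded by a single unit vector \<open>e\<close> whose orthogonal
  complement is negative definite, so later arguments need no orthogonal basis.\<close>

locale lorentz_form =
  fixes B :: "'v::euclidean_space \<Rightarrow> 'v \<Rightarrow> real" and e :: 'v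
  assumes bilinear: "bilinear B"
    and sym: "B x y = B y x"
    and unit: "B e e = 1"
    and neg: "\<lbrakk>B x e = 0; x \<noteq> 0\<rbrakk> \<Longrightarrow> B x x < 0"
begin

lemmas B_simps [simp] =
  bilinear_ladd[OF bilinear] bilinear_radd[OF bilinear] bilinear_lmul[OF bilinear]
  bilinear_rmul[OF bilinear] bilinear_lneg[OF bilinear] bilinear_rneg[OF bilinear]
  bilinear_lzero[OF bilinear] bilinear_rzero[OF bilinear]
  bilinear_lsub[OF bilinear] bilinear_rsub[OF bilinear]

lemma linear_right: "linear (B x)"
  using bilinear by (auto simp: bilinear_def)

text \<open>The combination \<open>?z\<close> is orthogonal to \<open>e\<close>, yet its square is a
  sum of nonnegative terms because the cross term vanishes; hence \<open>?z\<close> is zero. Applied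
  later mostly to null vectors, where orthogonality forces proportionality.\<close>

lemma nonneg_orthogonal_imp_proportional:
  assumes x: "x \<noteq> 0" "B x x \<ge> 0" and y: "B y y \<ge> 0" and xy: "B x y = 0"
  shows "\<exists>c. y = c *\<^sub>R x"
proof -
  have xe: "B x e \<noteq> 0" using neg[of x] x by auto
  let ?z = "B y e *\<^sub>R x - B x e *\<^sub>R y"
  have "B ?z ?z = (B y e)\<^sup>2 * B x x + (B x e)\<^sup>2 * B y y"
    using xy sym[of y x] by (simp add: power2_eq_square algebra_simps)
  then have "B ?z ?z \<ge> 0" using x y by simp
  moreover have "B ?z e = 0" by simp
  ultimately have "?z = 0" using neg[of ?z] by force
  then have "(1 / B x e) *\<^sub>R (B y e *\<^sub>R x) = (1 / B x e) *\<^sub>R (B x e *\<^sub>R y)" by simp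
  also have "\<dots> = y" using xe by simp
  finally have "y = (B y e / B x e) *\<^sub>R x" by simp
  then show ?thesis ..
qed

lemma timelike_perp_neg:
  assumes t: "B t t > 0" and v: "B v t = 0" "v \<noteq> 0"
  shows "B v v < 0"
proof (rule ccontr)
  assume "\<not> B v v < 0"
  moreover have "t \<noteq> 0" using t by auto
  ultimately obtain c where "v = c *\<^sub>R t"
    using nonneg_orthogonal_imp_proportional[of t v] t v sym[of t v] by fastforce
  then show False using v t by auto
qed

text \<open>Frees the choice of the reference vector: the final proof replaces the one supplied by
  the signature with a vector of \<open>H\<close>.\<close>

lemma lorentz_form_timelike: "B t t = 1 \<Longrightarrow> lorentz_form B t"
  using timelike_perp_neg[of t] bilinear sym by unfold_locales auto

lemma nondegenerate:
  assumes "\<And>y. B x y = 0" shows "x = 0"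
  using neg[of x] assms by force

text \<open>The map \<open>J\<close> represents \<open>B\<close> through the Euclidean inner product
  and is bijective by nondegeneracy; \<open>v\<close> is the preimage of the Euclidean component of
  \<open>z\<close> orthogonal to \<open>A\<close>. By contraposition this acts as the double
  orthogonal complement theorem.\<close>

lemma separate_subspace:
  assumes A: "subspace A" and z: "z \<notin> A"
  shows "\<exists>v. (\<forall>a\<in>A. B v a = 0) \<and> B v z \<noteq> 0"
proof -
  define J where "J v = (\<Sum>b\<in>Basis. B v b *\<^sub>R b)" for v
  have J: "J v \<bullet> w = B v w" for v w
  proof -
    have "B v w = B v (\<Sum>b\<in>Basis. (w \<bullet> b) *\<^sub>R b)" by (simp add: euclidean_representation)
    also have "\<dots> = (\<Sum>b\<in>Basis. (w \<bullet> b) * B v b)"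
      by (simp only: linear_sum[OF linear_right] linear_cmul[OF linear_right] real_scaleR_def)
    finally show ?thesis
      unfolding J_def inner_sum_left inner_scaleR_left
      by (simp only: inner_commute[of w] mult.commute[of "B v _"])
  qed
  have lin: "linear J"
    by (rule linearI) (simp_all add: J_def sum.distrib scaleR_left_distrib scaleR_right.sum)
  have "inj J"
    unfolding linear_injective_0[OF lin] using J nondegenerate by (metis inner_zero_left)
  then have "surj J" using lin by (simp add: linear_injective_imp_surjective)
  obtain a f where af: "a \<in> span A" "\<And>w. w \<in> span A \<Longrightarrow> f \<bullet> w = 0" "z = a + f"
    using orthogonal_subspace_decomp_exists[of A z] unfolding Linear_Algebra.orthogonal_def by metis
  obtain v where v: "J v = f" using \<open>surj J\<close> by (metis surjD)
  have "f \<noteq> 0" using af z A by (auto simp: span_eq_iff[THEN iffD2])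
  have "B v a' = 0" if "a' \<in> span A" for a'
    using af(2)[OF that] J[of v a'] v by simp
  moreover have "B v f \<noteq> 0" using \<open>f \<noteq> 0\<close> J[of v f] v by (metis inner_eq_zero_iff)
  ultimately show ?thesis using af by (intro exI[of _ v]) (auto simp: span_base)
qed

end

section \<open>Isometries of a Lorentzian form and their eigenvectors\<close>

locale lorentz_isometry = lorentz_form B e for B :: "'v::euclidean_space \<Rightarrow> 'v \<Rightarrow> real" and e +
  fixes T :: "'v \<Rightarrow> 'v"
  assumes linear_T: "linear T" and isometry: "B (T x) (T y) = B x y"
begin

lemmas T_simps [simp] = linear_add[OF linear_T] linear_diff[OF linear_T] linear_cmul[OF linear_T]
  linear_0[OF linear_T] linear_neg[OF linear_T]

lemma inj_T: "inj T"
  unfolding linear_injective_0[OF linear_T]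
  by (metis isometry nondegenerate B_simps(7))

lemma surj_T: "surj T"
  using inj_T linear_T by (simp add: linear_injective_imp_surjective)

text \<open>The adjoint of \<open>T\<close> is its inverse, so a vector orthogonal to the image of
  \<open>T - l\<close> is an eigenvector of the inverse for \<open>l\<close>.\<close>

lemma perp_range:
  assumes "l \<noteq> 0" "\<And>x. B v (T x - l *\<^sub>R x) = 0"
  shows "T v = (1 / l) *\<^sub>R v"
proof -
  have "B (T v - (1 / l) *\<^sub>R v) y = 0" for y
  proof -
    obtain x where y: "y = T x" using surj_T by (metis surjD)
    have "B v (T x) = l * B v x" using assms(2)[of x] by simp
    then show ?thesis using assms(1) by (simp add: y isometry)
  qed
  then show ?thesis using nondegenerate[of "T v - (1 / l) *\<^sub>R v"] by simp
qed

lemma subspace_range_shift: "subspace (range (\<lambda>x. T x - l *\<^sub>R x))"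
proof -
  have "linear (\<lambda>x. T x - l *\<^sub>R x)"
    by (rule linearI) (simp_all add: algebra_simps)
  then show ?thesis by (metis linear_subspace_image subspace_UNIV)
qed

text \<open>In finite dimension \<open>T - l\<close> is not surjective once it is not injective, and
  a vector orthogonal to its image is the eigenvector sought.\<close>

lemma eigenvalue_inverse:
  assumes x: "T x = l *\<^sub>R x" "x \<noteq> 0" and l: "l \<noteq> 0"
  shows "\<exists>v. v \<noteq> 0 \<and> T v = (1 / l) *\<^sub>R v"
proof -
  let ?f = "\<lambda>x. T x - l *\<^sub>R x"
  have lin: "linear ?f" by (rule linearI) (simp_all add: algebra_simps)
  have "\<not> inj ?f" using x unfolding linear_injective_0[OF lin] by auto
  then have "\<not> surj ?f" using lin linear_surjective_imp_injective by blast
  then obtain z where "z \<notin> range ?f" by auto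
  from separate_subspace[OF subspace_range_shift this]
  obtain v where v: "\<And>x. B v (?f x) = 0" "B v z \<noteq> 0" by auto
  then have "v \<noteq> 0" by auto
  with perp_range[OF l v(1)] show ?thesis by blast
qed

text \<open>A fixed null vector \<open>x\<close> lies in \<open>im (T - 1)\<close>, which is the orthogonal complement of
  \<open>ker (T - 1)\<close>, unless that kernel contains a timelike vector; a preimage of \<open>x\<close> is orthogonal to
  \<open>x\<close> and hence lies in \<open>im (T - 1) + ker (T - 1)\<close>.\<close>
lemma fixed_null_vector:
  assumes x: "T x = x" "x \<noteq> 0" "B x x = 0"
    and noE: "\<And>v. T v = v \<Longrightarrow> B v v \<le> 0"
  shows "\<exists>u. T (T u - u) - (T u - u) = x"
proof -
  let ?S = "\<lambda>x. T x - 1 *\<^sub>R x"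
  have fixed: "T v = v" if "\<And>y. B v (?S y) = 0" for v
    using perp_range[of 1 v] that by simp
  have Bvx: "B v x = 0" if v: "T v = v" for v
  proof (rule ccontr)
    assume n: "B v x \<noteq> 0"
    \<comment> \<open>As \<open>x\<close> is null, the square of \<open>v + s x\<close> is affine in
      \<open>s\<close>; this value makes it 1 and yields a fixed timelike vector, which
      \<open>noE\<close> excludes.\<close>
    define s where "s = (1 - B v v) / (2 * B v x)"
    have "B (v + s *\<^sub>R x) (v + s *\<^sub>R x) = B v v + 2 * s * B v x"
      using x sym[of x v] by simp
    also have "2 * s * B v x = 1 - B v v" using n by (simp add: s_def)
    finally have "B (v + s *\<^sub>R x) (v + s *\<^sub>R x) = 1" by simp
    then show False using noE[of "v + s *\<^sub>R x"] v x by simp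
  qed
  have "x \<in> range ?S"
  proof (rule ccontr)
    assume "x \<notin> range ?S"
    from separate_subspace[OF subspace_range_shift this]
    obtain v where "\<And>y. B v (?S y) = 0" "B v x \<noteq> 0" by auto
    with fixed Bvx show False by blast
  qed
  then obtain y where y: "x = T y - y" by auto
  have "B (T y) (T y) = B y y" by (rule isometry)
  moreover have Ty: "T y = y + x" using y by simp
  ultimately have yx: "B y x = 0" using x sym[of x y] by simp
  have subK: "subspace {k. T k = k}" by (auto simp: subspace_def)
  let ?A = "{a + k | a k. a \<in> range ?S \<and> k \<in> {k. T k = k}}"
  have subA: "subspace ?A" by (rule subspace_sums[OF subspace_range_shift subK])
  have "y \<in> ?A"
  proof (rule ccontr)
    assume "y \<notin> ?A"
    from separate_subspace[OF subA this] obtain v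
      where v: "\<And>a. a \<in> ?A \<Longrightarrow> B v a = 0" and vy: "B v y \<noteq> 0" by blast
    have "?S z \<in> ?A" for z
      by (rule CollectI, rule exI[of _ "?S z"], rule exI[of _ 0]) simp
    then have Tv: "T v = v" using v fixed by blast
    \<comment> \<open>Being fixed, \<open>v\<close> lies in the kernel summand of \<open>?A\<close>,
      to which it is also orthogonal. So it is null and a multiple of \<open>x\<close>, but
      \<open>x\<close> is orthogonal to \<open>y\<close>.\<close>
    have "v \<in> ?A"
      by (rule CollectI, rule exI[of _ 0], rule exI[of _ v])
         (auto simp: Tv intro: image_eqI[of _ _ 0])
    then have "B v v = 0" by (rule v)
    then obtain c where "v = c *\<^sub>R x"
      using nonneg_orthogonal_imp_proportional[of x v] x Bvx[OF Tv] sym[of x v] by auto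
    then show False using vy yx sym[of x y] by simp
  qed
  then obtain u k where uk: "y = (T u - u) + k" "T k = k" by auto
  have "T (T u - u) - (T u - u) = T y - y" by (simp add: uk)
  then show ?thesis using y by auto
qed

end

section \<open>The hyperboloid\<close>

context lorentz_form
begin

lemma continuous_on_B [continuous_intros]:
  "\<lbrakk>continuous_on S f; continuous_on S g\<rbrakk> \<Longrightarrow> continuous_on S (\<lambda>x. B (f x) (g x))"
  using bilinear by (auto simp: bilinear_conv_bounded_bilinear intro: bounded_bilinear.continuous_on)

text \<open>The closed ball of the Klein model: no nonzero nonspacelike vector is orthogonal to
  \<open>e\<close>, so every nonspacelike line meets the slice \<open>B x e = 1\<close> exactly
  once.\<close>

definition nonspacelike_ball :: "'v set" where "nonspacelike_ball = {x. B x e = 1 \<and> B x x \<ge> 0}"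

lemma e_in_nonspacelike_ball: "e \<in> nonspacelike_ball"
  by (simp add: nonspacelike_ball_def unit)

lemma closed_nonspacelike_ball: "closed nonspacelike_ball"
  unfolding nonspacelike_ball_def by (intro closed_Collect_conj closed_Collect_eq closed_Collect_le continuous_intros)

text \<open>Reversing the sign of \<open>B\<close> on the complement of \<open>e\<close> gives the
  positive definite form \<open>P\<close>, which is at most 2 on the ball. Its minimum on the unit
  sphere turns this into a norm bound.\<close>

lemma bounded_nonspacelike_ball: "bounded nonspacelike_ball"
proof -
  define P where "P x = 2 * (B x e)\<^sup>2 - B x x" for x
  have pos: "P x > 0" if "x \<noteq> 0" for x
  proof (cases "B x e = 0")
    case False
    let ?y = "x - B x e *\<^sub>R e"
    have "B ?y e = 0" by (simp add: unit)
    then have "B ?y ?y \<le> 0" using neg[of ?y] by (cases "?y = 0") auto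
    moreover have "P x = (B x e)\<^sup>2 - B ?y ?y"
      by (simp add: P_def unit sym[of e x] power2_eq_square)
    ultimately show ?thesis using False by (smt (verit) zero_less_power2)
  qed (use neg[of x] that in \<open>simp add: P_def\<close>)
  have "sphere (0::'v) 1 \<noteq> {}" by simp
  moreover have "continuous_on (sphere 0 1) P"
    unfolding P_def by (intro continuous_intros)
  ultimately obtain a where a: "a \<in> sphere 0 1" "\<And>x. x \<in> sphere 0 1 \<Longrightarrow> P a \<le> P x"
    using continuous_attains_inf[of "sphere 0 1" P] by auto
  have "a \<noteq> 0" using a by auto
  then have Pa: "P a > 0" by (rule pos)
  have bound: "P a * (norm x)\<^sup>2 \<le> P x" for x
  proof (cases "x = 0")
    case False
    let ?u = "(1 / norm x) *\<^sub>R x"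
    have "P a \<le> P ?u" by (rule a(2)) (simp add: False)
    also have "P ?u = P x / (norm x)\<^sup>2"
      by (simp add: P_def power2_eq_square diff_divide_distrib)
    finally show ?thesis using False by (simp add: field_simps)
  qed (simp add: P_def)
  have "norm x \<le> sqrt (2 / P a)" if "x \<in> nonspacelike_ball" for x
  proof -
    have "P a * (norm x)\<^sup>2 \<le> 2" using bound[of x] that by (simp add: nonspacelike_ball_def P_def)
    then have "(norm x)\<^sup>2 \<le> 2 / P a" using Pa by (simp add: field_simps)
    then show "norm x \<le> sqrt (2 / P a)" by (rule real_le_rsqrt)
  qed
  then show ?thesis unfolding bounded_iff by blast
qed

text \<open>The difference of two points of the slice is orthogonal to \<open>e\<close>, so the
  correction term \<open>- u * v * B (x - y) (x - y)\<close> of the convex combination is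
  nonnegative.\<close>

lemma convex_nonspacelike_ball: "convex nonspacelike_ball"
proof (rule convexI)
  fix x y and u v :: real
  assume xy: "x \<in> nonspacelike_ball" "y \<in> nonspacelike_ball" and uv: "0 \<le> u" "0 \<le> v" "u + v = 1"
  have "B (x - y) e = 0" using xy by (simp add: nonspacelike_ball_def)
  then have "B (x - y) (x - y) \<le> 0" using neg[of "x - y"] by (cases "x - y = 0") auto
  then have "u * v * B (x - y) (x - y) \<le> 0" using uv by (simp add: mult_nonneg_nonpos)
  moreover have "0 \<le> u * B x x" "0 \<le> v * B y y" using uv xy by (simp_all add: nonspacelike_ball_def)
  ultimately have "0 \<le> u * B x x + v * B y y - u * v * B (x - y) (x - y)" by linarith
  also have "\<dots> = B (u *\<^sub>R x + v *\<^sub>R y) (u *\<^sub>R x + v *\<^sub>R y)"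
  proof -
    have v: "v = 1 - u" using uv by simp
    show ?thesis unfolding v by (simp add: sym[of y x] algebra_simps)
  qed
  finally show "u *\<^sub>R x + v *\<^sub>R y \<in> nonspacelike_ball"
    using xy uv by (simp add: nonspacelike_ball_def)
qed

text \<open>Pairing with \<open>e\<close> never vanishes on the hyperboloid, so its sign is constant
  on a component. Conversely, the segment from \<open>e\<close> to \<open>v\<close> stays timelike,
  and rescaling it gives a path within the hyperboloid.\<close>

lemma component_hyperboloid:
  assumes H: "H \<in> components {v. B v v = 1}" and e: "e \<in> H"
  shows "H = {v. B v v = 1 \<and> B v e > 0}"
proof (intro equalityI subsetI CollectI conjI)
  fix v assume v: "v \<in> H"
  have sub: "H \<subseteq> {v. B v v = 1}" using H by (rule in_components_subset)
  then show "B v v = 1" using v by auto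
  show "B v e > 0"
  proof (rule ccontr)
    assume "\<not> B v e > 0"
    moreover have "connected ((\<lambda>x. B x e) ` H)"
      using in_components_connected[OF H] by (intro connected_continuous_image continuous_intros)
    moreover have "B e e \<in> (\<lambda>x. B x e) ` H" "B v e \<in> (\<lambda>x. B x e) ` H" using e v by auto
    ultimately have "{B v e..B e e} \<subseteq> (\<lambda>x. B x e) ` H" by (intro connected_contains_Icc)
    then have "0 \<in> (\<lambda>x. B x e) ` H" using \<open>\<not> B v e > 0\<close> unit by auto
    then obtain y where y: "y \<in> H" "B y e = 0" by auto
    then have "B y y = 1" using sub by auto
    then show False using neg[of y] y by force
  qed
next
  fix v assume "v \<in> {v. B v v = 1 \<and> B v e > 0}"
  then have v: "B v v = 1" "B v e > 0" by auto
  define w where "w t = (1 - t) *\<^sub>R e + t *\<^sub>R v" for t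
  have w: "B (w t) (w t) > 0" if "t \<in> {0..1}" for t
  proof -
    have "B (w t) (w t) = (1 - t)\<^sup>2 + t\<^sup>2 + 2 * t * (1 - t) * B v e"
      using v by (simp add: w_def unit sym[of e v] power2_eq_square algebra_simps)
    moreover have "2 * t * (1 - t) * B v e \<ge> 0" using that v by (intro mult_nonneg_nonneg) auto
    moreover have "(1 - t)\<^sup>2 + t\<^sup>2 > 0" by (cases "t = 0") (auto simp: add_nonneg_pos)
    ultimately show ?thesis by linarith
  qed
  define k where "k t = (1 / sqrt (B (w t) (w t))) *\<^sub>R w t" for t
  have "continuous_on {0..1} w" unfolding w_def by (intro continuous_intros)
  moreover have "sqrt (B (w t) (w t)) \<noteq> 0" if "t \<in> {0..1}" for t using w[OF that] by simp
  ultimately have "continuous_on {0..1} k"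
    unfolding k_def by (intro continuous_intros) auto
  then have "connected (k ` {0..1})" by (intro connected_continuous_image) auto
  moreover have "k ` {0..1} \<subseteq> {v. B v v = 1}"
  proof (rule image_subsetI)
    fix t :: real assume "t \<in> {0..1}"
    from w[OF this] show "k t \<in> {v. B v v = 1}" by (simp add: k_def)
  qed
  moreover have "k 0 = e" "k 1 = v" using v by (simp_all add: k_def w_def unit)
  then have "e \<in> k ` {0..1}" "v \<in> k ` {0..1}" by force+
  ultimately show "v \<in> H"
    using components_maximal[OF H, of "k ` {0..1}"] e by auto
qed

end

section \<open>Invariant nonspacelike directions and the three types of isometries\<close>

context lorentz_isometry
begin

text \<open>Brouwer's theorem applies to the projective action of \<open>T\<close> on the ball of nonspacelike
  directions.\<close>
lemma nonspacelike_eigenvector: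
  assumes Te: "B (T e) e > 0"
  shows "\<exists>x l. x \<noteq> 0 \<and> B x x \<ge> 0 \<and> l > 0 \<and> T x = l *\<^sub>R x"
proof -
  have pos: "B (T x) e > 0" if x: "x \<in> nonspacelike_ball" for x
  proof (rule ccontr)
    assume n: "\<not> B (T x) e > 0"
    define h where "h = B (T x) e"
    define k where "k = B (T e) e"
    have hk: "h \<le> 0" "k > 0" using n Te by (auto simp: h_def k_def)
    \<comment> \<open>The coefficients put the image of \<open>?z\<close> into the complement of
      \<open>e\<close>, while \<open>h \<le> 0\<close> keeps \<open>?z\<close> nonspacelike. So
      \<open>?z\<close> vanishes, and pairing it with \<open>e\<close> gives \<open>k = h\<close>,
      contradicting the signs.\<close>
    let ?z = "k *\<^sub>R x - h *\<^sub>R e"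
    have xe: "B x e = 1" "B e x = 1" "B x x \<ge> 0" using x sym[of e x] by (auto simp: nonspacelike_ball_def)
    have "B (T ?z) (T ?z) = k\<^sup>2 * B x x + h\<^sup>2 - 2 * (h * k)"
      unfolding isometry using xe by (simp add: unit power2_eq_square algebra_simps)
    moreover have "h * k \<le> 0" "k\<^sup>2 * B x x \<ge> 0" using hk xe by (simp_all add: mult_nonpos_nonneg)
    ultimately have "B (T ?z) (T ?z) \<ge> 0" using zero_le_power2[of h] by linarith
    moreover have "B (T ?z) e = 0" by (simp add: h_def k_def)
    ultimately have "T ?z = 0" using neg[of "T ?z"] by linarith
    then have "?z = 0" using inj_T linear_injective_0[OF linear_T] by blast
    then have "B ?z e = 0" by simp
    then show False using xe hk by (simp add: unit)
  qed
  \<comment> \<open>The image is rescaled back into the slice; a fixed point of \<open>f\<close> is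
    an eigenvector of \<open>T\<close> with positive eigenvalue.\<close>
  define f where "f x = (1 / B (T x) e) *\<^sub>R T x" for x
  have "continuous_on nonspacelike_ball T"
    using linear_T by (simp add: linear_conv_bounded_linear linear_continuous_on)
  then have "continuous_on nonspacelike_ball f"
    unfolding f_def by (intro continuous_intros) (use pos in force)+
  moreover have "f \<in> nonspacelike_ball \<rightarrow> nonspacelike_ball"
  proof
    fix x assume x: "x \<in> nonspacelike_ball"
    have "B (f x) (f x) = (1 / B (T x) e)\<^sup>2 * B x x"
      by (simp add: f_def isometry power2_eq_square)
    then show "f x \<in> nonspacelike_ball" using x pos[OF x] by (simp add: nonspacelike_ball_def f_def)
  qed
  moreover have "compact nonspacelike_ball" using bounded_nonspacelike_ball closed_nonspacelike_ball by (simp add: compact_eq_bounded_closed)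
  ultimately obtain x where x: "x \<in> nonspacelike_ball" "f x = x"
    using brouwer[of nonspacelike_ball f] convex_nonspacelike_ball e_in_nonspacelike_ball by blast
  have "B (T x) e *\<^sub>R f x = T x" using pos[OF x(1)] by (simp add: f_def)
  then have "T x = B (T x) e *\<^sub>R x" using x by simp
  moreover have "x \<noteq> 0" using x by (auto simp: nonspacelike_ball_def)
  ultimately show ?thesis using pos[OF x(1)] x by (intro exI[of _ x] exI[of _ "B (T x) e"]) (auto simp: nonspacelike_ball_def)
qed

text \<open>A positive eigenvalue other than 1 gives the hyperbolic case at once. For eigenvalue 1
  without a fixed timelike vector, the eigenvector is null and lies in the image of the square of
  \<open>T - 1\<close>.\<close>

lemma trichotomy:
  assumes Te: "B (T e) e > 0"
  obtains (elliptic) v where "T v = v" "B v v > 0"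
    | (hyperbolic) x l where "T x = l *\<^sub>R x" "x \<noteq> 0" "l\<^sup>2 \<noteq> 1"
    | (parabolic) u where "T (T u - u) - (T u - u) \<noteq> 0"
        "T (T (T u - u) - (T u - u)) - (T (T u - u) - (T u - u)) = 0"
proof -
  obtain x l where x: "x \<noteq> 0" "B x x \<ge> 0" "l > 0" "T x = l *\<^sub>R x"
    using nonspacelike_eigenvector[OF Te] by blast
  show thesis
  proof (cases "l = 1")
    case False
    then show thesis using x hyperbolic[of x l] by (simp add: power2_eq_1_iff)
  next
    case True
    show thesis
    proof (cases "\<exists>v. T v = v \<and> B v v > 0")
      case False
      then have "B x x = 0" using x True by force
      then obtain u where u: "T (T u - u) - (T u - u) = x"
        using fixed_null_vector[of x] x True False by force
      show thesis by (rule parabolic[of u]; unfold u) (use x True in simp_all)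
    qed (use elliptic in blast)
  qed
qed

text \<open>The image of \<open>H\<close> is connected, lies on the hyperboloid and meets
  \<open>H\<close> in the image of \<open>e\<close>, so it stays in \<open>H\<close>. The inverse
  satisfies the same positivity condition, which gives equality.\<close>

lemma preserves_component:
  assumes Te: "B (T e) e > 0" and H: "H \<in> components {v. B v v = 1}" and e: "e \<in> H"
  shows "T ` H = H"
proof -
  have sub: "H \<subseteq> {v. B v v = 1}" using H by (rule in_components_subset)
  have img: "S ` H \<subseteq> H" if S: "linear S" "\<And>x. B (S x) (S x) = B x x" "B (S e) e > 0" for S
  proof (rule components_maximal[OF H])
    have "continuous_on H S"
      using S by (simp add: linear_conv_bounded_linear linear_continuous_on)
    then show "connected (S ` H)"
      using in_components_connected[OF H] by (rule connected_continuous_image)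
    show "S ` H \<subseteq> {v. B v v = 1}" using S sub by auto
    have "S e \<in> H" using component_hyperboloid[OF H e] S unit by auto
    then show "H \<inter> S ` H \<noteq> {}" using e by auto
  qed
  obtain S where S: "linear S" "S \<circ> T = id" "T \<circ> S = id"
    using linear_T inj_T surj_T linear_injective_isomorphism[OF linear_T inj_T]
    by (metis comp_def eq_id_iff)
  have TS: "T (S x) = x" for x using S by (metis comp_apply id_apply)
  have "B (S x) (S y) = B x y" for x y using isometry[of "S x" "S y"] by (simp add: TS)
  moreover have "B (S e) e = B (T e) e" using isometry[of "S e" e] TS sym by simp
  ultimately have "S ` H \<subseteq> H" using S Te by (intro img) auto
  then have "T ` S ` H \<subseteq> T ` H" by (rule image_mono)
  then have "H \<subseteq> T ` H" by (simp add: image_image TS)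
  moreover have "T ` H \<subseteq> H" by (rule img) (auto simp: linear_T isometry Te)
  ultimately show ?thesis by blast
qed

end

section \<open>Characteristic polynomials of restrictions to invariant subspaces\<close>

lemma representation_list:
  assumes "distinct us" "independent (set us)" "i < length us"
  shows "representation (set us) (\<Sum>j<length us. c j *\<^sub>R us ! j) (us ! i) = c i"
proof -
  have sp: "us ! j \<in> span (set us)" if "j < length us" for j
    using that by (simp add: span_base)
  have "representation (set us) (\<Sum>j<length us. c j *\<^sub>R us ! j) (us ! i)
      = (\<Sum>j<length us. c j * representation (set us) (us ! j) (us ! i))"
    by (subst real_vector.representation_sum[OF assms(2)])
       (simp_all add: real_vector.representation_scale[OF assms(2)] sp span_scale)
  also have "\<dots> = (\<Sum>j<length us. if i = j then c j else 0)"
    using assms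
    by (intro sum.cong refl) (simp add: real_vector.representation_basis nth_eq_iff_index_eq)
  also have "\<dots> = c i" using assms by simp
  finally show ?thesis .
qed

lemma representation_list_expansion:
  assumes "distinct us" "independent (set us)" "v \<in> span (set us)"
  shows "(\<Sum>i<length us. representation (set us) v (us ! i) *\<^sub>R us ! i) = v"
proof -
  have "(\<Sum>i<length us. representation (set us) v (us ! i) *\<^sub>R us ! i)
      = (\<Sum>b\<in>set us. representation (set us) v b *\<^sub>R b)"
    using assms
    by (intro sum.reindex_bij_betw[of "(!) us" _ _ "\<lambda>b. representation (set us) v b *\<^sub>R b"])
       (auto intro: bij_betw_nth)
  also have "\<dots> = v"
    using assms by (intro real_vector.sum_representation_eq) auto
  finally show ?thesis .
qed

lemma independent_list_sum_eq_0:
  assumes "distinct us" "independent (set us)" "(\<Sum>j<length us. c j *\<^sub>R us ! j) = 0" "i < length us"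
  shows "c i = 0"
  using representation_list[OF assms(1,2,4), of c] assms(3)
  by (simp add: real_vector.representation_zero)

lemma matrix_wrt_carrier: "matrix_wrt bs bs T \<in> carrier_mat (length bs) (length bs)"
  by (simp add: matrix_wrt_def)

text \<open>\<open>x\<close> and \<open>y\<close> are the combinations of \<open>us\<close> whose
  coefficients are the real and imaginary parts of a complex eigenvector of the matrix. For real
  \<open>z\<close> one of them may be zero.\<close>

lemma char_poly_root_imp_invariant_pair:
  fixes T :: "'v::real_vector \<Rightarrow> 'v" and z :: complex
  assumes T: "linear T" and us: "distinct us" "independent (set us)"
    and inv: "\<And>u. u \<in> span (set us) \<Longrightarrow> T u \<in> span (set us)"
    and root: "poly (map_poly of_real (char_poly (matrix_wrt us us T))) z = 0"
  shows "\<exists>x\<in>span (set us). \<exists>y\<in>span (set us). (x \<noteq> 0 \<or> y \<noteq> 0) \<and>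
    T x = Re z *\<^sub>R x - Im z *\<^sub>R y \<and> T y = Im z *\<^sub>R x + Re z *\<^sub>R y"
proof -
  define n where "n = length us"
  define A where "A = matrix_wrt us us T"
  have A: "A \<in> carrier_mat n n" by (simp add: A_def n_def matrix_wrt_carrier)
  then have A': "map_mat complex_of_real A \<in> carrier_mat n n" by simp
  have "poly (char_poly (map_mat complex_of_real A)) z = 0"
    using root of_real_hom.char_poly_hom[OF A, where 'a = complex] by (simp add: A_def)
  then obtain w where "eigenvector (map_mat complex_of_real A) w z"
    using eigenvalue_root_char_poly[OF A'] by (auto simp: eigenvalue_def)
  then have w: "w \<in> carrier_vec n" "w \<noteq> 0\<^sub>v n" "map_mat complex_of_real A *\<^sub>v w = z \<cdot>\<^sub>v w"
    using A by (auto simp: eigenvector_def)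
  have Aw: "(\<Sum>j<n. of_real (A $$ (i, j)) * w $ j) = z * w $ i" if i: "i < n" for i
  proof -
    have "(map_mat complex_of_real A *\<^sub>v w) $ i = (z \<cdot>\<^sub>v w) $ i" using w by simp
    then show ?thesis using i A w(1) by (auto simp: scalar_prod_def atLeast0LessThan)
  qed
  have Tus: "T (us ! j) = (\<Sum>i<n. A $$ (i, j) *\<^sub>R us ! i)" if j: "j < n" for j
  proof -
    have "T (us ! j) \<in> span (set us)" using j by (intro inv span_base) (simp add: n_def)
    from representation_list_expansion[OF us this] show ?thesis
      using j by (simp add: A_def matrix_wrt_def n_def)
  qed
  define comb where "comb c = (\<Sum>j<n. c j *\<^sub>R us ! j)" for c :: "nat \<Rightarrow> real"
  have Tcomb: "T (comb c) = comb (\<lambda>i. \<Sum>j<n. A $$ (i, j) * c j)" for c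
  proof -
    have "T (comb c) = (\<Sum>j<n. \<Sum>i<n. (A $$ (i, j) * c j) *\<^sub>R us ! i)"
      by (simp add: comb_def linear_sum[OF T] linear_cmul[OF T] Tus scaleR_right.sum mult.commute)
    also have "\<dots> = (\<Sum>i<n. \<Sum>j<n. (A $$ (i, j) * c j) *\<^sub>R us ! i)"
      by (rule sum.swap)
    finally show ?thesis by (simp add: comb_def scaleR_left.sum)
  qed
  have span: "comb c \<in> span (set us)" for c
    unfolding comb_def by (intro span_sum span_scale span_base) (simp add: n_def)
  let ?x = "comb (\<lambda>j. Re (w $ j))" and ?y = "comb (\<lambda>j. Im (w $ j))"
  have "?x \<noteq> 0 \<or> ?y \<noteq> 0"
  proof (rule ccontr)
    assume "\<not> (?x \<noteq> 0 \<or> ?y \<noteq> 0)"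
    then have "Re (w $ j) = 0" "Im (w $ j) = 0" if "j < n" for j
      using independent_list_sum_eq_0[OF us, of "\<lambda>j. Re (w $ j)" j]
        independent_list_sum_eq_0[OF us, of "\<lambda>j. Im (w $ j)" j] that by (auto simp: comb_def n_def)
    then have "w = 0\<^sub>v n" using w by (intro eq_vecI) (auto simp: complex_eq_iff)
    then show False using w by simp
  qed
  moreover have "(\<Sum>j<n. A $$ (i, j) * Re (w $ j)) = Re (z * w $ i)"
    "(\<Sum>j<n. A $$ (i, j) * Im (w $ j)) = Im (z * w $ i)" if "i < n" for i
    using arg_cong[OF Aw[OF that], of Re] arg_cong[OF Aw[OF that], of Im] by simp_all
  then have "T ?x = comb (\<lambda>i. Re (z * w $ i))" "T ?y = comb (\<lambda>i. Im (z * w $ i))"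
    unfolding Tcomb by (simp_all add: comb_def)
  then have "T ?x = Re z *\<^sub>R ?x - Im z *\<^sub>R ?y" "T ?y = Im z *\<^sub>R ?x + Re z *\<^sub>R ?y"
    by (simp_all add: comb_def scaleR_right.sum sum_subtractf[symmetric] sum.distrib[symmetric]
        algebra_simps)
  ultimately show ?thesis using span by blast
qed

lemma char_poly_block_diagonal:
  fixes M A :: "'a::idom mat"
  assumes M: "M \<in> carrier_mat n n" and A: "A \<in> carrier_mat m m"
  shows "char_poly (four_block_mat M (0\<^sub>m n m) (0\<^sub>m m n) A) = char_poly M * char_poly A"
proof -
  have "char_poly_matrix (four_block_mat M (0\<^sub>m n m) (0\<^sub>m m n) A)
     = four_block_mat (char_poly_matrix M) (0\<^sub>m n m) (0\<^sub>m m n) (char_poly_matrix A)"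
    using M A by (intro eq_matI) (auto simp: char_poly_matrix_def)
  then show ?thesis
    unfolding char_poly_def
    by (simp add: det_four_block_mat_upper_right_zero[OF char_poly_matrix_closed[OF M] refl _
          char_poly_matrix_closed[OF A]])
qed

text \<open>Invariance of both spans makes the matrix block diagonal. The product formula later
  allows the factor of the part already matched to be cancelled.\<close>

lemma operator_char_poly_invariant_decomposition:
  fixes T :: "'v::euclidean_space \<Rightarrow> 'v"
  assumes T: "linear T" and basis: "list_basis (bs @ us)"
    and bs: "\<And>v. v \<in> span (set bs) \<Longrightarrow> T v \<in> span (set bs)"
    and us: "\<And>v. v \<in> span (set us) \<Longrightarrow> T v \<in> span (set us)"
  shows "operator_char_poly T = char_poly (matrix_wrt bs bs T) * char_poly (matrix_wrt us us T)"
proof -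
  let ?S = "set (bs @ us)"
  have ind: "independent ?S" and dist: "distinct bs" "distinct us" "set bs \<inter> set us = {}"
    using basis by (auto simp: list_basis_def)
  have rb: "representation ?S v = representation (set bs) v" if "v \<in> span (set bs)" for v
    using that by (intro real_vector.representation_extend[OF ind]) auto
  have ru: "representation ?S v = representation (set us) v" if "v \<in> span (set us)" for v
    using that by (intro real_vector.representation_extend[OF ind]) auto
  have z: "representation (set bs) v (us ! i) = 0" if "i < length us" for v i
    using that dist nth_mem[OF that] real_vector.representation_ne_zero[of "set bs" v "us ! i"]
    by blast
  have z': "representation (set us) v (bs ! i) = 0" if "i < length bs" for v i
    using that dist nth_mem[OF that] real_vector.representation_ne_zero[of "set us" v "bs ! i"]
    by blast
  have "matrix_wrt (bs @ us) (bs @ us) T = four_block_mat (matrix_wrt bs bs T)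
     (0\<^sub>m (length bs) (length us)) (0\<^sub>m (length us) (length bs)) (matrix_wrt us us T)"
  proof (rule eq_matI, goal_cases)
    case (1 i j)
    then have "i < length bs + length us" "j < length bs + length us"
      by (simp_all add: matrix_wrt_def)
    then show ?case
      using rb[OF bs[OF span_base], of "bs ! j"] ru[OF us[OF span_base], of "us ! (j - length bs)"]
      by (cases "i < length bs"; cases "j < length bs")
         (simp_all add: matrix_wrt_def nth_append z z')
  qed (simp_all add: matrix_wrt_def)
  then show ?thesis
    unfolding operator_char_poly_eq[OF basis T]
    by (simp add: char_poly_block_diagonal matrix_wrt_carrier)
qed

lemma char_poly_complex_root:
  assumes A: "A \<in> carrier_mat n n" and n: "n > 0"
  shows "\<exists>z::complex. poly (map_poly of_real (char_poly A)) z = 0"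
proof -
  have "degree (map_poly of_real (char_poly A) :: complex poly) = n"
    using degree_monic_char_poly[OF A] by simp
  then show ?thesis
    using n fundamental_theorem_of_algebra_alt[of "map_poly of_real (char_poly A) :: complex poly"]
    by (metis degree_pCons_0 not_less_zero)
qed

section \<open>Jordan chains and the minimal polynomial\<close>

lemma poly_operator_linear_factor_power:
  assumes "linear T"
  shows "poly_operator ([:- l, 1:] ^ k) T v = ((\<lambda>x. T x - l *\<^sub>R x) ^^ k) v"
proof (induction k arbitrary: v)
  case (Suc k)
  have "poly_operator [:- l, 1:] T x = T x - l *\<^sub>R x" for x
    by (simp add: poly_operator_pCons)
  then show ?case by (simp only: power_Suc poly_operator_mult[OF assms] Suc funpow.simps comp_apply)
qed (simp add: one_pCons poly_operator_pCons)

lemma poly_operator_eigenvector: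
  assumes T: "linear T" and v: "T v = l *\<^sub>R v"
  shows "poly_operator q T v = poly q l *\<^sub>R v"
proof (induction q)
  case (pCons a q)
  then show ?case
    by (simp add: poly_operator_pCons v linear_cmul[OF linear_poly_operator[OF T]] scaleR_left_distrib)
qed simp

text \<open>By induction \<open>T - l\<close> already kills \<open>w\<close>; then \<open>q\<close>
  acts on this eigenvector as the nonzero scalar \<open>poly q l\<close>.\<close>

lemma poly_operator_coprime_linear_factor:
  assumes T: "linear T" and q: "poly q l \<noteq> 0"
    and "poly_operator ([:- l, 1:] ^ n) T w = 0" "poly_operator q T w = 0"
  shows "w = 0"
  using assms(3,4)
proof (induction n arbitrary: w)
  case 0
  then show ?case by (simp add: one_pCons poly_operator_pCons)
next
  case (Suc n)
  let ?p = "[:- l, 1:]"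
  have "poly_operator (?p ^ n) T (poly_operator ?p T w) = 0"
    using Suc.prems(1) unfolding power_Suc2 poly_operator_mult[OF T] .
  moreover have "poly_operator q T (poly_operator ?p T w) = 0"
    using Suc.prems(2) linear_0[OF linear_poly_operator[OF T]]
    by (metis poly_operator_mult[OF T] mult.commute)
  ultimately have "poly_operator ?p T w = 0" by (rule Suc.IH)
  then have "T w = l *\<^sub>R w" by (simp add: poly_operator_pCons)
  from poly_operator_eigenvector[OF T this, of q] show ?case using q Suc.prems(2) by simp
qed

text \<open>Such a chain exists exactly when the power \<open>Suc k\<close> of the factor for
  \<open>l\<close> divides the minimal polynomial, a condition that does not mention the
  operator.\<close>

lemma Jordan_chain_same_min_poly:
  fixes T T' :: "'v::euclidean_space \<Rightarrow> 'v"
  assumes T: "linear T" and T': "linear T'" and eq: "operator_min_poly T = operator_min_poly T'"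
    and u: "((\<lambda>x. T x - l *\<^sub>R x) ^^ k) u \<noteq> 0" "((\<lambda>x. T x - l *\<^sub>R x) ^^ Suc k) u = 0"
  shows "\<exists>u'. ((\<lambda>x. T' x - l *\<^sub>R x) ^^ k) u' \<noteq> 0 \<and> ((\<lambda>x. T' x - l *\<^sub>R x) ^^ Suc k) u' = 0"
proof -
  define p where "p = [:- l, 1:]"
  define m where "m = operator_min_poly T"
  have m: "is_min_poly T m" "is_min_poly T' m"
    using is_min_poly_operator_min_poly[OF T] is_min_poly_operator_min_poly[OF T'] eq by (simp_all add: m_def)
  have "m \<noteq> 0" using m by (auto simp: is_min_poly_def)
  then obtain j q where q: "m = p ^ j * q" "\<not> p dvd q"
    using order_decomp[of m l] unfolding p_def by blast
  have zero: "poly_operator r T 0 = 0" for r by (rule linear_0[OF linear_poly_operator[OF T]])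
  have u': "poly_operator (p ^ k) T u \<noteq> 0" "poly_operator (p ^ Suc k) T u = 0"
    using u unfolding p_def poly_operator_linear_factor_power[OF T] by auto
  have "Suc k \<le> j"
  proof (rule ccontr)
    assume "\<not> Suc k \<le> j"
    then have k: "p ^ k = p ^ (k - j) * p ^ j" by (simp flip: power_add)
    \<comment> \<open>If \<open>j \<le> k\<close>, then \<open>w\<close> is killed both by
      \<open>q\<close> and by a power of \<open>p\<close>, hence is zero; this would make the chain
      too short.\<close>
    define w where "w = poly_operator (p ^ j) T u"
    have "poly_operator q T w = poly_operator m T u"
      unfolding w_def poly_operator_mult[OF T, symmetric] q(1) by (simp only: mult.commute)
    also have "\<dots> = 0" using m by (simp add: is_min_poly_def)
    finally have 1: "poly_operator q T w = 0" .
    have "poly_operator (p ^ Suc k) T w = poly_operator (p ^ j) T (poly_operator (p ^ Suc k) T u)"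
      unfolding w_def poly_operator_mult[OF T, symmetric] by (simp only: mult.commute)
    then have 2: "poly_operator (p ^ Suc k) T w = 0" by (simp only: u' zero)
    have "poly q l \<noteq> 0" using q(2) unfolding p_def poly_eq_0_iff_dvd .
    then have "w = 0" using poly_operator_coprime_linear_factor[OF T _ 2[unfolded p_def] 1] by blast
    then show False
      using u'(1) unfolding k poly_operator_mult[OF T] by (simp add: w_def[symmetric] zero)
  qed
  define r where "r = p ^ (j - Suc k) * q"
  have mr: "m = p ^ Suc k * r"
    using \<open>Suc k \<le> j\<close> q(1) unfolding r_def mult.assoc[symmetric] power_add[symmetric]
    by simp
  \<comment> \<open>\<open>n\<close> is the minimal polynomial with one factor \<open>p\<close>
    removed. Its smaller degree keeps it from annihilating \<open>T'\<close>, and a vector it does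
    not kill produces the chain.\<close>
  define n where "n = p ^ k * r"
  have mn: "m = p * n" by (simp add: mr n_def mult.assoc)
  have "lead_coeff m = lead_coeff n" unfolding mn lead_coeff_mult by (simp add: p_def)
  then have "monic n" using m by (simp add: is_min_poly_def)
  moreover have "degree n < degree m"
  proof -
    have "n \<noteq> 0" using \<open>monic n\<close> by auto
    then have "degree m = degree p + degree n" unfolding mn by (intro degree_mult_eq) (auto simp: p_def)
    then show ?thesis by (simp add: p_def)
  qed
  ultimately obtain v where v: "poly_operator n T' v \<noteq> 0"
    using m(2) unfolding is_min_poly_def by force
  let ?u = "poly_operator r T' v"
  have "poly_operator (p ^ k) T' ?u \<noteq> 0"
    using v by (simp add: n_def poly_operator_mult[OF T'])
  moreover have "poly_operator (p ^ Suc k) T' ?u = 0"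
    using m(2) unfolding is_min_poly_def mr poly_operator_mult[OF T'] by blast
  ultimately show ?thesis
    unfolding p_def poly_operator_linear_factor_power[OF T'] by blast
qed

section \<open>Partial intertwiners\<close>

context lorentz_form
begin

text \<open>The graph of an isometry between invariant subspaces of \<open>T\<close> and \<open>T'\<close> which intertwines the
  two operators. The timelike vector makes the orthogonal complements of these subspaces negative
  definite.\<close>
definition partial_intertwiner :: "('v \<Rightarrow> 'v) \<Rightarrow> ('v \<Rightarrow> 'v) \<Rightarrow> ('v \<times> 'v) set \<Rightarrow> bool" where
  "partial_intertwiner T T' G \<longleftrightarrow> subspace G \<and>
     (\<forall>p\<in>G. (T (fst p), T' (snd p)) \<in> G) \<and>
     (\<forall>p\<in>G. \<forall>q\<in>G. B (fst p) (fst q) = B (snd p) (snd q)) \<and>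
     (\<exists>p\<in>G. B (fst p) (fst p) > 0)"

text \<open>Invariance and isometry pass from generators to the span by linearity, so starting
  blocks and extensions can be given by finitely many new pairs.\<close>

lemma partial_intertwiner_span:
  assumes T: "linear T" "linear T'"
    and inv: "\<And>a b. (a, b) \<in> X \<Longrightarrow> (T a, T' b) \<in> span X"
    and iso: "\<And>a b a' b'. \<lbrakk>(a, b) \<in> X; (a', b') \<in> X\<rbrakk> \<Longrightarrow> B a a' = B b b'"
    and t: "\<exists>p\<in>span X. B (fst p) (fst p) > 0"
  shows "partial_intertwiner T T' (span X)"
  unfolding partial_intertwiner_def
proof (intro conjI ballI)
  fix p assume "p \<in> span X"
  then show "(T (fst p), T' (snd p)) \<in> span X"
  proof (induction rule: span_induct_alt)
    case base
    then show ?case using T by (simp add: linear_0 span_0 flip: zero_prod_def)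
  next
    case (step c x y)
    have "(T (fst x), T' (snd x)) \<in> span X" using inv[of "fst x" "snd x"] step by simp
    then have "c *\<^sub>R (T (fst x), T' (snd x)) + (T (fst y), T' (snd y)) \<in> span X"
      using step by (intro span_add span_scale)
    then show ?case using T by (simp add: linear_add linear_cmul)
  qed
next
  have iso1: "B (fst p) (fst q) = B (snd p) (snd q)" if p: "p \<in> span X" and q: "q \<in> X" for p q
    using p
  proof (induction rule: span_induct_alt)
    case (step c x y)
    then show ?case using iso[of "fst x" "snd x" "fst q" "snd q"] q by simp
  qed simp
  fix p q assume p: "p \<in> span X" and "q \<in> span X"
  from this(2) show "B (fst p) (fst q) = B (snd p) (snd q)"
  proof (induction rule: span_induct_alt)
    case (step c x y)
    then show ?case using iso1[OF p] by simp
  qed simp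
qed (use t in auto)

text \<open>Transfers statements about first components to second components, in particular
  injectivity.\<close>

lemma partial_intertwiner_converse:
  assumes G: "partial_intertwiner T T' G"
  shows "partial_intertwiner T' T (prod.swap ` G)"
proof -
  have "linear (prod.swap :: 'v \<times> 'v \<Rightarrow> 'v \<times> 'v)"
    by (rule linearI) (auto simp: prod.swap_def)
  then have "subspace (prod.swap ` G)"
    using G by (intro linear_subspace_image) (auto simp: partial_intertwiner_def)
  moreover obtain p where "p \<in> G" "B (fst p) (fst p) > 0"
    using G unfolding partial_intertwiner_def by blast
  then have "\<exists>p\<in>prod.swap ` G. B (fst p) (fst p) > 0"
    using G by (intro bexI[of _ "prod.swap p"]) (force simp: partial_intertwiner_def)+
  ultimately show ?thesis
    using G unfolding partial_intertwiner_def by force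
qed

text \<open>The second component of a pair with first component zero is null and orthogonal to a
  timelike vector, hence zero. So the set really is the graph of a map.\<close>

lemma partial_intertwiner_inj_fst:
  assumes G: "partial_intertwiner T T' G"
  shows "inj_on fst G"
proof (rule inj_onI)
  fix p q assume pq: "p \<in> G" "q \<in> G" "fst p = fst q"
  have "p - q \<in> G" using G pq by (auto simp: partial_intertwiner_def intro: subspace_diff)
  obtain t where t: "t \<in> G" "B (fst t) (fst t) > 0"
    using G unfolding partial_intertwiner_def by blast
  have iso: "B (fst p) (fst q) = B (snd p) (snd q)" if "p \<in> G" "q \<in> G" for p q
    using G that by (auto simp: partial_intertwiner_def)
  have "B (snd t) (snd t) > 0" "B (snd (p - q)) (snd t) = 0" "B (snd (p - q)) (snd (p - q)) = 0"
    using iso[OF t(1) t(1)] iso[OF \<open>p - q \<in> G\<close> t(1)] iso[OF \<open>p - q \<in> G\<close> \<open>p - q \<in> G\<close>] t pq by auto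
  then have "snd (p - q) = 0" using timelike_perp_neg[of "snd t" "snd (p - q)"] by force
  then show "p = q" using pq by (simp add: prod_eq_iff)
qed

end

section \<open>Orthogonal complements of invariant subspaces\<close>

context lorentz_isometry
begin

lemma perp_complement:
  assumes W: "subspace W" and TW: "\<And>w. w \<in> W \<Longrightarrow> T w \<in> W"
    and t: "t \<in> W" "B t t > 0"
    and bs: "distinct bs" "independent (set bs)" "span (set bs) = W"
  obtains us where "distinct us" "independent (set us)"
    "\<And>u. u \<in> span (set us) \<longleftrightarrow> (\<forall>w\<in>W. B u w = 0)"
    "\<And>u. u \<in> span (set us) \<Longrightarrow> T u \<in> span (set us)"
    "list_basis (bs @ us)"
proof -
  define U where "U = {u. \<forall>w\<in>W. B u w = 0}"
  have U: "subspace U" by (auto simp: U_def subspace_def)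
  have negU: "u = 0" if "u \<in> U" "B u u = 0" for u
    using timelike_perp_neg[of t u] t that by (force simp: U_def)
  have WU: "W \<inter> U = {0}"
    using negU subspace_0[OF W] subspace_0[OF U] by (auto simp: U_def)
  have sum: "{x + y |x y. x \<in> W \<and> y \<in> U} = UNIV"
  proof (rule ccontr)
    assume "{x + y |x y. x \<in> W \<and> y \<in> U} \<noteq> UNIV"
    then obtain z where "z \<notin> {x + y |x y. x \<in> W \<and> y \<in> U}" by blast
    from separate_subspace[OF subspace_sums[OF W U] this] obtain v
      where v: "\<And>a. a \<in> {x + y |x y. x \<in> W \<and> y \<in> U} \<Longrightarrow> B v a = 0" and vz: "B v z \<noteq> 0"
      by blast
    have "B v w = 0" if "w \<in> W" for w
      by (rule v) (use that subspace_0[OF U] in force)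
    then have "v \<in> U" by (simp add: U_def)
    then have "v \<in> {x + y |x y. x \<in> W \<and> y \<in> U}" using subspace_0[OF W] by force
    then have "v = 0" using negU \<open>v \<in> U\<close> v by blast
    then show False using vz by simp
  qed
  have dim: "dim W + dim U = DIM('v)"
    using dim_sums_Int[OF W U] by (simp add: sum WU)
  have "T ` W = W"
  proof (rule subspace_dim_equal)
    show "subspace (T ` W)" by (rule linear_subspace_image[OF linear_T W])
    show "dim W \<le> dim (T ` W)"
      using dim_image_eq[OF linear_T, of W] inj_T inj_on_subset by (metis order_refl subset_UNIV)
  qed (use W TW in auto)
  have TU: "T u \<in> U" if "u \<in> U" for u
  proof -
    have "B (T u) w = 0" if w: "w \<in> W" for w
    proof -
      obtain w' where "w' \<in> W" "w = T w'" using w \<open>T ` W = W\<close> by blast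
      then show ?thesis using \<open>u \<in> U\<close> by (simp add: isometry U_def)
    qed
    then show ?thesis by (simp add: U_def)
  qed
  obtain Us where Us: "Us \<subseteq> U" "independent Us" "U \<subseteq> span Us" "card Us = dim U"
    using basis_exists by blast
  then obtain us where us: "set us = Us" "distinct us"
    using finite_distinct_list finiteI_independent by metis
  have spanU: "span (set us) = U"
    using Us us U by (metis span_subspace)
  have disj: "set bs \<inter> set us = {}"
  proof -
    have "set bs \<inter> set us \<subseteq> W \<inter> U" using bs(3) spanU span_superset by blast
    moreover have "0 \<notin> set us" using Us us dependent_zero by auto
    ultimately show ?thesis using WU by auto
  qed
  have span: "span (set (bs @ us)) = UNIV"
  proof -
    have "{x + y |x y. x \<in> W \<and> y \<in> U} \<subseteq> span (set (bs @ us))"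
      using bs(3) spanU span_mono[of "set bs" "set (bs @ us)"] span_mono[of "set us" "set (bs @ us)"]
      by (auto intro!: span_add)
    then show ?thesis using sum by auto
  qed
  have "card (set bs) = dim W" using bs by (metis dim_span_eq_card_independent)
  then have "card (set (bs @ us)) = DIM('v)"
    using dim Us(4) us(1) card_Un_disjoint[OF _ _ disj] finiteI_independent[OF Us(2)] by simp
  then have "independent (set (bs @ us))"
    by (intro card_le_dim_spanning[of _ UNIV]) (use span in auto)
  then have "list_basis (bs @ us)"
    using span disj bs us by (auto simp: list_basis_def)
  then show thesis
    using that[of us] us Us spanU TU by (auto simp: U_def)
qed

end

text \<open>Applied to both projections of a graph, this shows that the two restricted operators
  have the same matrix.\<close>

lemma representation_map:
  assumes f: "linear f" "inj_on f (span (set ps))" and ps: "distinct ps" "independent (set ps)"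
    and v: "v \<in> span (set ps)" and i: "i < length ps"
  shows "representation (set (map f ps)) (f v) (map f ps ! i) = representation (set ps) v (ps ! i)"
proof -
  have ind: "independent (set (map f ps))"
    using linear_independent_injective_image[OF f(1) ps(2) f(2)] by simp
  have dist: "distinct (map f ps)"
    using ps f by (simp add: distinct_map inj_on_subset span_superset)
  have "f v = f (\<Sum>j<length ps. representation (set ps) v (ps ! j) *\<^sub>R ps ! j)"
    by (simp add: representation_list_expansion[OF ps v])
  also have "\<dots> = (\<Sum>j<length (map f ps). representation (set ps) v (ps ! j) *\<^sub>R map f ps ! j)"
    by (simp add: linear_sum[OF f(1)] linear_cmul[OF f(1)])
  finally show ?thesis
    using representation_list[OF dist ind, of i "\<lambda>j. representation (set ps) v (ps ! j)"] i by simp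
qed

section \<open>Extension of a partial intertwiner by one block\<close>

context lorentz_form
begin

text \<open>A block of a complementary invariant subspace is spanned by \<open>u\<close> and \<open>T u\<close>, and its Gram
  matrix is determined by the eigenvalue \<open>z\<close>.\<close>
lemma invariant_block:
  assumes T: "lorentz_isometry B e T" and us: "distinct us" "independent (set us)"
    and inv: "\<And>u. u \<in> span (set us) \<Longrightarrow> T u \<in> span (set us)"
    and neg': "\<And>u. \<lbrakk>u \<in> span (set us); u \<noteq> 0\<rbrakk> \<Longrightarrow> B u u < 0"
    and root: "poly (map_poly of_real (char_poly (matrix_wrt us us T))) (z :: complex) = 0"
  shows "\<exists>u\<in>span (set us). B u u = -1 \<and> B u (T u) = - 2 * Re z / (1 + (cmod z)\<^sup>2) \<and>
    T (T u) = (2 * Re z) *\<^sub>R T u - (cmod z)\<^sup>2 *\<^sub>R u"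
proof -
  interpret lorentz_isometry B e T by (rule T)
  define a b where "a = Re z" and "b = Im z"
  obtain x y where xy: "x \<in> span (set us)" "y \<in> span (set us)" "x \<noteq> 0 \<or> y \<noteq> 0"
    "T x = a *\<^sub>R x - b *\<^sub>R y" "T y = b *\<^sub>R x + a *\<^sub>R y"
    using char_poly_root_imp_invariant_pair[OF linear_T us inv root] by (auto simp: a_def b_def)
  \<comment> \<open>On the span of \<open>x\<close> and \<open>y\<close> the square of
    \<open>T - a\<close> is multiplication by minus the square of \<open>b\<close>. Both vectors
    satisfy the relation, so \<open>v\<close> can be whichever is nonzero.\<close>
  have "T (T v) = (2 * a) *\<^sub>R T v - (a\<^sup>2 + b\<^sup>2) *\<^sub>R v" if "v = x \<or> v = y" for v
    using that by (auto simp: xy(4,5) algebra_simps power2_eq_square simp flip: scaleR_left_distrib)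
  then obtain v where v: "v \<in> span (set us)" "v \<noteq> 0" "T (T v) = (2 * a) *\<^sub>R T v - (a\<^sup>2 + b\<^sup>2) *\<^sub>R v"
    using xy(1-3) by blast
  define k where "k = 1 / sqrt (- B v v)"
  define u where "u = k *\<^sub>R v"
  have TTu: "T (T u) = (2 * a) *\<^sub>R T u - (a\<^sup>2 + b\<^sup>2) *\<^sub>R u"
    using v(3) by (simp add: u_def scaleR_right_diff_distrib mult_ac)
  have Bv: "B v v < 0" using neg' v by blast
  have "k\<^sup>2 = 1 / (- B v v)" unfolding k_def power_divide using Bv by simp
  moreover have "B u u = k\<^sup>2 * B v v" by (simp add: u_def power2_eq_square)
  ultimately have uu: "B u u = -1" using Bv by simp
  \<comment> \<open>Substituting the quadratic relation into this identity gives a linear equation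
    for \<open>B u (T u)\<close> whose coefficient \<open>1 + (a\<^sup>2 + b\<^sup>2)\<close> is
    positive.\<close>
  have "B u (T u) = B (T u) (T (T u))" by (simp only: isometry)
  also have "\<dots> = 2 * a * B (T u) (T u) - (a\<^sup>2 + b\<^sup>2) * B u (T u)"
    unfolding TTu by (simp add: sym[of "T u" u])
  finally have "B u (T u) * (1 + (a\<^sup>2 + b\<^sup>2)) = - 2 * a"
    by (simp add: isometry uu algebra_simps)
  moreover have "1 + (a\<^sup>2 + b\<^sup>2) > 0" by (simp add: add_pos_nonneg)
  ultimately have "B u (T u) = - 2 * a / (1 + (a\<^sup>2 + b\<^sup>2))"
    by (metis less_irrefl nonzero_mult_div_cancel_right)
  moreover have "(cmod z)\<^sup>2 = a\<^sup>2 + b\<^sup>2" by (simp add: a_def b_def cmod_power2)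
  moreover have "u \<in> span (set us)" using v by (simp add: u_def span_scale)
  ultimately show ?thesis using uu TTu unfolding a_def by (intro bexI[of _ u]) auto
qed

text \<open>The operators agree on the parts matched by \<open>G\<close>, so their characteristic
  polynomials on the complements coincide. A common complex root there supplies blocks with equal
  Gram matrices and equal recurrences, which are adjoined to \<open>G\<close>.\<close>

lemma partial_intertwiner_extend:
  assumes T: "lorentz_isometry B e T" and T': "lorentz_isometry B e T'"
    and chi: "operator_char_poly T = operator_char_poly T'"
    and G: "partial_intertwiner T T' G" and proper: "fst ` G \<noteq> UNIV"
  shows "\<exists>G'. partial_intertwiner T T' G' \<and> dim G < dim G'"
proof -
  interpret T: lorentz_isometry B e T by (rule T)
  interpret T': lorentz_isometry B e T' by (rule T')
  have sub: "subspace G" and inv: "\<And>p. p \<in> G \<Longrightarrow> (T (fst p), T' (snd p)) \<in> G"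
    and iso: "\<And>p q. \<lbrakk>p \<in> G; q \<in> G\<rbrakk> \<Longrightarrow> B (fst p) (fst q) = B (snd p) (snd q)"
    using G by (auto simp: partial_intertwiner_def)
  obtain t where t: "t \<in> G" "B (fst t) (fst t) > 0"
    using G unfolding partial_intertwiner_def by blast
  then have t': "B (snd t) (snd t) > 0" using iso[OF t(1) t(1)] by simp
  have lin: "linear (fst :: 'v \<times> 'v \<Rightarrow> 'v)" "linear (snd :: 'v \<times> 'v \<Rightarrow> 'v)"
    by (simp_all add: linear_conv_bounded_linear bounded_linear_fst bounded_linear_snd)
  have "inj_on (fst \<circ> prod.swap) G"
    using partial_intertwiner_inj_fst[OF partial_intertwiner_converse[OF G]]
    by (intro comp_inj_on) simp_all
  then have inj: "inj_on fst G" "inj_on snd G"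
    using partial_intertwiner_inj_fst[OF G] by (simp_all add: comp_def)
  obtain Ps where Ps: "Ps \<subseteq> G" "independent Ps" "G \<subseteq> span Ps" "card Ps = dim G"
    using basis_exists by blast
  then obtain ps where ps: "set ps = Ps" "distinct ps"
    using finite_distinct_list finiteI_independent by metis
  have spanG: "span (set ps) = G" using Ps ps sub by (metis span_subspace)
  have ind: "independent (set ps)" using Ps ps by simp
  define bs bs' where "bs = map fst ps" and "bs' = map snd ps"
  have sp: "span (set bs) = fst ` G" "span (set bs') = snd ` G"
    using linear_span_image[OF lin(1), of "set ps"] linear_span_image[OF lin(2), of "set ps"] spanG
    by (simp_all add: bs_def bs'_def)
  have indb: "independent (set bs)" "independent (set bs')"
    using linear_independent_injective_image[OF lin(1) ind]
      linear_independent_injective_image[OF lin(2) ind] inj spanG by (simp_all add: bs_def bs'_def)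
  have dist: "distinct bs" "distinct bs'"
    using ps inj Ps by (auto simp: bs_def bs'_def distinct_map intro: inj_on_subset)
  \<comment> \<open>Both sides are the matrix, in the basis \<open>ps\<close> of \<open>G\<close>,
    of the map acting by \<open>T\<close> on first and by \<open>T'\<close> on second
    components.\<close>
  have matrix_eq: "matrix_wrt bs bs T = matrix_wrt bs' bs' T'"
  proof (rule eq_matI)
    fix i j assume "i < dim_row (matrix_wrt bs' bs' T')" "j < dim_col (matrix_wrt bs' bs' T')"
    then have i: "i < length ps" and j: "j < length ps" by (simp_all add: matrix_wrt_def bs'_def)
    define q where "q = (T (fst (ps ! j)), T' (snd (ps ! j)))"
    have q: "q \<in> span (set ps)" using inv[of "ps ! j"] j spanG Ps(1) ps(1) nth_mem[OF j]
      by (auto simp: q_def)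
    show "matrix_wrt bs bs T $$ (i, j) = matrix_wrt bs' bs' T' $$ (i, j)"
      using representation_map[OF lin(1) _ ps(2) ind q i] representation_map[OF lin(2) _ ps(2) ind q i]
        inj spanG i j by (simp add: matrix_wrt_def bs_def bs'_def q_def)
  qed (simp_all add: matrix_wrt_def bs_def bs'_def)
  have subW: "subspace (fst ` G)" "subspace (snd ` G)"
    using sub lin by (auto intro: linear_subspace_image)
  have TW: "T w \<in> fst ` G" if w: "w \<in> fst ` G" for w
  proof -
    obtain p where "p \<in> G" "w = fst p" using w by blast
    then show ?thesis using inv[of p] by force
  qed
  have TW': "T' w \<in> snd ` G" if w: "w \<in> snd ` G" for w
  proof -
    obtain p where "p \<in> G" "w = snd p" using w by blast
    then show ?thesis using inv[of p] by force
  qed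
  obtain us where us: "distinct us" "independent (set us)"
    "\<And>u. u \<in> span (set us) \<longleftrightarrow> (\<forall>w\<in>fst ` G. B u w = 0)"
    "\<And>u. u \<in> span (set us) \<Longrightarrow> T u \<in> span (set us)" "list_basis (bs @ us)"
    using T.perp_complement[OF subW(1) TW imageI[OF t(1)] t(2) dist(1) indb(1) sp(1)] by metis
  obtain us' where us': "distinct us'" "independent (set us')"
    "\<And>u. u \<in> span (set us') \<longleftrightarrow> (\<forall>w\<in>snd ` G. B u w = 0)"
    "\<And>u. u \<in> span (set us') \<Longrightarrow> T' u \<in> span (set us')" "list_basis (bs' @ us')"
    using T'.perp_complement[OF subW(2) TW' imageI[OF t(1)] t' dist(2) indb(2) sp(2)] by metis
  have negU: "B u u < 0" if "u \<in> span (set us)" "u \<noteq> 0" for u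
    using timelike_perp_neg[OF t(2), of u] us(3) that t by blast
  have negU': "B u u < 0" if "u \<in> span (set us')" "u \<noteq> 0" for u
    using timelike_perp_neg[OF t', of u] us'(3) that t by blast
  have "char_poly (matrix_wrt bs bs T) * char_poly (matrix_wrt us us T)
      = char_poly (matrix_wrt bs bs T) * char_poly (matrix_wrt us' us' T')"
    using operator_char_poly_invariant_decomposition[OF T.linear_T us(5)]
      operator_char_poly_invariant_decomposition[OF T'.linear_T us'(5)]
      sp TW TW' us(4) us'(4) chi by (simp add: matrix_eq)
  moreover have "char_poly (matrix_wrt bs bs T) \<noteq> 0"
    using degree_monic_char_poly[OF matrix_wrt_carrier[of bs T]] by auto
  ultimately have chi_U: "char_poly (matrix_wrt us us T) = char_poly (matrix_wrt us' us' T')"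
    by simp
  have "us \<noteq> []"
    using proper sp(1) us(5) by (auto simp: list_basis_def)
  then obtain z :: complex where z: "poly (map_poly of_real (char_poly (matrix_wrt us us T))) z = 0"
    using char_poly_complex_root[OF matrix_wrt_carrier[of us T]] by auto
  obtain u where u: "u \<in> span (set us)" "B u u = -1" "B u (T u) = - 2 * Re z / (1 + (cmod z)\<^sup>2)"
    "T (T u) = (2 * Re z) *\<^sub>R T u - (cmod z)\<^sup>2 *\<^sub>R u"
    using invariant_block[OF T us(1,2,4) negU z] by blast
  obtain u' where u': "u' \<in> span (set us')" "B u' u' = -1"
    "B u' (T' u') = - 2 * Re z / (1 + (cmod z)\<^sup>2)"
    "T' (T' u') = (2 * Re z) *\<^sub>R T' u' - (cmod z)\<^sup>2 *\<^sub>R u'"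
    using invariant_block[OF T' us'(1,2,4) negU' z[unfolded chi_U]] by blast
  define X where "X = G \<union> {(u, u'), (T u, T' u')}"
  have perp: "B u (fst p) = 0" "B (T u) (fst p) = 0" "B u' (snd p) = 0" "B (T' u') (snd p) = 0"
    if "p \<in> G" for p
    using that us(3,4) us'(3,4) u(1) u'(1) by blast+
  have "partial_intertwiner T T' (span X)"
  proof (rule partial_intertwiner_span)
    fix a b assume "(a, b) \<in> X"
    then consider "(a, b) \<in> G" | "(a, b) = (u, u')" | "(a, b) = (T u, T' u')" by (auto simp: X_def)
    then show "(T a, T' b) \<in> span X"
    proof cases
      case 1
      then show ?thesis using inv[of "(a, b)"] by (auto simp: X_def intro: span_base)
    next
      case 2
      then show ?thesis by (auto simp: X_def intro: span_base)
    next
      case 3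
      have "(2 * Re z) *\<^sub>R (T u, T' u') - (cmod z)\<^sup>2 *\<^sub>R (u, u') \<in> span X"
        by (intro span_diff span_scale span_base) (auto simp: X_def)
      then show ?thesis using 3 u u' by simp
    qed
  next
    fix a b a' b' assume "(a, b) \<in> X" "(a', b') \<in> X"
    then show "B a a' = B b b'"
      unfolding X_def
      using iso[of "(a, b)" "(a', b')"] perp[of "(a, b)"] perp[of "(a', b')"]
        u(2,3) u'(2,3) T.isometry[of u u] T'.isometry[of u' u']
        sym[of "T u" u] sym[of "T' u'" u'] sym[of a u] sym[of a "T u"] sym[of b u'] sym[of b "T' u'"]
      by auto
  next
    show "\<exists>p\<in>span X. B (fst p) (fst p) > 0"
      using t by (intro bexI[of _ t]) (auto simp: X_def intro: span_base)
  qed (rule T.linear_T T'.linear_T)+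
  moreover have "dim G < dim (span X)"
  proof (rule dim_psubset)
    \<comment> \<open>Membership would make \<open>u\<close> orthogonal to itself, against
      \<open>B u u = -1\<close>.\<close>
    have "(u, u') \<notin> G" using perp(1)[of "(u, u')"] u(2) by auto
    moreover have "(u, u') \<in> span X" "G \<subseteq> span X" by (auto simp: X_def intro: span_base)
    ultimately show "span G \<subset> span (span X)" using sub by (auto simp: span_eq_iff[THEN iffD2])
  qed
  ultimately show ?thesis by blast
qed

text \<open>Each extension raises the dimension, which is bounded by that of the product space. When
  the first projection is onto, the graph defines \<open>g\<close> everywhere.\<close>

lemma partial_intertwiner_total:
  assumes T: "lorentz_isometry B e T" and T': "lorentz_isometry B e T'"
    and chi: "operator_char_poly T = operator_char_poly T'"
    and G: "partial_intertwiner T T' G"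
  shows "\<exists>g. linear g \<and> (\<forall>x y. B (g x) (g y) = B x y) \<and> (\<forall>x. g (T x) = T' (g x))"
  using G
proof (induction "DIM('v \<times> 'v) - dim G" arbitrary: G rule: less_induct)
  case less
  show ?case
  proof (cases "fst ` G = UNIV")
    case False
    then obtain G' where G': "partial_intertwiner T T' G'" "dim G < dim G'"
      using partial_intertwiner_extend[OF T T' chi less.prems] by blast
    have "dim G' \<le> DIM('v \<times> 'v)" by (rule dim_subset_UNIV)
    then show ?thesis using less.hyps[OF _ G'(1)] G'(2) by simp
  next
    case True
    have sub: "subspace G" and inv: "\<And>a b. (a, b) \<in> G \<Longrightarrow> (T a, T' b) \<in> G"
      and iso: "\<And>a b a' b'. \<lbrakk>(a, b) \<in> G; (a', b') \<in> G\<rbrakk> \<Longrightarrow> B a a' = B b b'"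
      using less.prems unfolding partial_intertwiner_def by force+
    have uniq: "b = b'" if "(a, b) \<in> G" "(a, b') \<in> G" for a b b'
      using inj_onD[OF partial_intertwiner_inj_fst[OF less.prems], of "(a, b)" "(a, b')"] that by simp
    have "\<forall>a. \<exists>b. (a, b) \<in> G" using True by force
    then obtain g where g: "\<And>a. (a, g a) \<in> G" by metis
    have "linear g"
    proof (rule linearI)
      fix x y and c :: real
      show "g (x + y) = g x + g y"
        using subspace_add[OF sub g[of x] g[of y]] g[of "x + y"] uniq by simp
      show "g (c *\<^sub>R x) = c *\<^sub>R g x"
        using subspace_scale[OF sub g[of x], of c] g[of "c *\<^sub>R x"] uniq by simp
    qed
    moreover have "g (T x) = T' (g x)" for x using inv[OF g[of x]] g[of "T x"] uniq by blast
    moreover have "B (g x) (g y) = B x y" for x y using iso g by metis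
    ultimately show ?thesis by blast
  qed
qed

end

section \<open>The conjugacy theorem\<close>

context lorentz_isometry
begin

text \<open>Preserving \<open>B\<close> forces an eigenvector to be null when its eigenvalue does
  not square to 1. Orthogonal null eigenvectors for \<open>l\<close> and \<open>1 / l\<close> would
  be proportional, forcing \<open>l = 1 / l\<close>; so the pairing is nonzero and can be scaled to
  1.\<close>

lemma hyperbolic_pair:
  assumes x: "T x = l *\<^sub>R x" "x \<noteq> 0" "l\<^sup>2 \<noteq> 1"
  shows "\<exists>v. T v = (1 / l) *\<^sub>R v \<and> B x v = 1 \<and> B x x = 0 \<and> B v v = 0"
proof -
  have null: "B y y = 0" if y: "T y = m *\<^sub>R y" "m\<^sup>2 \<noteq> 1" for y m
    using isometry[of y y] y by (simp add: power2_eq_square)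
  have l: "l \<noteq> 0" using x inj_T linear_injective_0[OF linear_T] by auto
  obtain v where v: "v \<noteq> 0" "T v = (1 / l) *\<^sub>R v" using eigenvalue_inverse[OF x(1,2) l] by blast
  have "(1 / l)\<^sup>2 \<noteq> 1" using x(3) l by (simp add: power_divide)
  then have Bv: "B v v = 0" using null v by blast
  have Bx: "B x x = 0" using null x by blast
  have xv: "B x v \<noteq> 0"
  proof
    assume "B x v = 0"
    then obtain c where c: "v = c *\<^sub>R x"
      using nonneg_orthogonal_imp_proportional[of x v] x Bx Bv by auto
    then have "(c * l) *\<^sub>R x = (c / l) *\<^sub>R x" using v(2) x(1) by simp
    then have "c * l = c / l" using x(2) by (simp only: scaleR_cancel_right) simp
    moreover have "c \<noteq> 0" using c v(1) by auto
    ultimately show False using l x(3) by (simp add: field_simps power2_eq_square)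
  qed
  show ?thesis
    by (rule exI[of _ "(1 / B x v) *\<^sub>R v"]) (use v Bv Bx xv in simp)
qed

text \<open>The isometry condition on pairs from the chain expresses every Gram entry except
  \<open>B u u\<close> through \<open>B y y\<close>. Scaling and a shift of \<open>u\<close> then
  fix these two numbers.\<close>

lemma parabolic_chain:
  assumes u: "T (T u - u) - (T u - u) \<noteq> 0"
    "T (T (T u - u) - (T u - u)) - (T (T u - u) - (T u - u)) = 0"
  shows "\<exists>u y w. T u = u + y \<and> T y = y + w \<and> T w = w \<and> B u u = 0 \<and> B u y = 1 / 2 \<and>
    B u w = 1 \<and> B y y = - 1 \<and> B y w = 0 \<and> B w w = 0"
proof -
  define y where "y = T u - u"
  define w where "w = T y - y"
  have w0: "w \<noteq> 0" using u(1) unfolding y_def w_def .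
  have "T w - w = 0" using u(2) unfolding y_def w_def .
  then have Tw: "T w = w" by simp
  have Tu: "T u = u + y" and Ty: "T y = y + w" by (simp_all add: y_def w_def)
  have ww: "B w w = 0" using isometry[of y w] by (simp add: Ty Tw)
  have yw: "B y w = 0" using isometry[of y y] by (simp add: Ty ww sym[of w y])
  have uw: "B u w = - B y y" using isometry[of u y] by (simp add: Tu Ty yw)
  have uy: "B u y = - B y y / 2" using isometry[of u u] by (simp add: Tu sym[of y u])
  have yy: "B y y < 0"
  proof (rule ccontr)
    \<comment> \<open>Otherwise \<open>y\<close> is proportional to the null vector
      \<open>w\<close>, hence fixed, and \<open>w\<close> would be zero.\<close>
    assume "\<not> B y y < 0"
    then obtain c where "y = c *\<^sub>R w"
      using nonneg_orthogonal_imp_proportional[of w y] w0 ww yw sym[of w y] by auto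
    then have "T y = y" using Tw by simp
    then show False using w0 by (simp add: w_def)
  qed
  define k where "k = 1 / sqrt (- B y y)"
  have k: "k * (k * B y y) = -1"
    using yy by (simp add: k_def)
  have k': "k * (k * (k * (k * (B u u * B y y)))) = - (k * (k * B u u))"
  proof -
    have "k * (k * (k * (k * (B u u * B y y)))) = (k * (k * B u u)) * (k * (k * B y y))"
      by (simp only: mult_ac)
    then show ?thesis by (simp add: k)
  qed
  \<comment> \<open>Subtracting \<open>s * k\<close> times \<open>w\<close> cancels the square of
    the scaled \<open>u\<close>. The chain relations and other Gram entries survive because
    \<open>w\<close> is fixed, null and orthogonal to \<open>y\<close>.\<close>
  define s where "s = k * (k * B u u) / 2"
  show ?thesis
    by (rule exI[of _ "k *\<^sub>R u - (s * k) *\<^sub>R w"], rule exI[of _ "k *\<^sub>R y"], rule exI[of _ "k *\<^sub>R w"])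
       (use k k' in \<open>simp add: Tu Ty Tw ww yw uw uy sym[of w u] sym[of w y] s_def algebra_simps\<close>)
qed

end

context lorentz_form
begin

text \<open>The hyperbolic and parabolic alternatives pass between \<open>T\<close> and
  \<open>T'\<close> in both directions through the minimal polynomial. If both fail for
  \<open>T\<close>, they fail for \<open>T'\<close>, and each operator fixes a timelike
  vector.\<close>

lemma partial_intertwiner_exists:
  assumes T: "lorentz_isometry B e T" "B (T e) e > 0"
    and T': "lorentz_isometry B e T'" "B (T' e) e > 0"
    and eq: "operator_min_poly T = operator_min_poly T'"
  shows "\<exists>G. partial_intertwiner T T' G"
proof -
  interpret T: lorentz_isometry B e T by (rule T)
  interpret T': lorentz_isometry B e T' by (rule T')
  note lin = T.linear_T T'.linear_T
  have hyp: "\<exists>x. S' x = l *\<^sub>R x \<and> x \<noteq> 0"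
    if "linear S" "linear S'" "operator_min_poly S = operator_min_poly S'" "S x = l *\<^sub>R x" "x \<noteq> 0"
    for S S' :: "'v \<Rightarrow> 'v" and l x
    using Jordan_chain_same_min_poly[OF that(1-3), where l = l and k = 0 and u = x] that(4,5) by auto
  have par: "\<exists>u. S' (S' u - u) - (S' u - u) \<noteq> 0 \<and>
      S' (S' (S' u - u) - (S' u - u)) - (S' (S' u - u) - (S' u - u)) = 0"
    if "linear S" "linear S'" "operator_min_poly S = operator_min_poly S'"
      "S (S u - u) - (S u - u) \<noteq> 0" "S (S (S u - u) - (S u - u)) - (S (S u - u) - (S u - u)) = 0"
    for S S' :: "'v \<Rightarrow> 'v" and u
    using Jordan_chain_same_min_poly[OF that(1-3), where l = 1 and k = 2 and u = u] that(4,5)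
    by (simp add: numeral_2_eq_2)
  show ?thesis
  proof (cases "\<exists>x l. T x = l *\<^sub>R x \<and> x \<noteq> 0 \<and> l\<^sup>2 \<noteq> 1")
    case True
    then obtain x l where x: "T x = l *\<^sub>R x" "x \<noteq> 0" "l\<^sup>2 \<noteq> 1" by blast
    obtain x' where x': "T' x' = l *\<^sub>R x'" "x' \<noteq> 0" using hyp[OF lin eq x(1,2)] by blast
    obtain v where v: "T v = (1 / l) *\<^sub>R v" "B x v = 1" "B x x = 0" "B v v = 0"
      using T.hyperbolic_pair[OF x] by blast
    obtain v' where v': "T' v' = (1 / l) *\<^sub>R v'" "B x' v' = 1" "B x' x' = 0" "B v' v' = 0"
      using T'.hyperbolic_pair[OF x' x(3)] by blast
    let ?X = "{(x, x'), (v, v')}"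
    have "partial_intertwiner T T' (span ?X)"
    proof (rule partial_intertwiner_span[OF lin])
      have X: "l *\<^sub>R (x, x') \<in> span ?X" "(1 / l) *\<^sub>R (v, v') \<in> span ?X"
        by (intro span_scale span_base; simp)+
      fix a b assume "(a, b) \<in> ?X"
      then show "(T a, T' b) \<in> span ?X" using X x x' v v' by auto
    next
      \<comment> \<open>The sum of two null vectors with pairing 1 has square 2, which supplies the
        timelike vector.\<close>
      have "(x, x') + (v, v') \<in> span ?X" by (intro span_add span_base) auto
      then show "\<exists>p\<in>span ?X. B (fst p) (fst p) > 0"
        using v sym[of v x] by (intro bexI[of _ "(x, x') + (v, v')"]) auto
    qed (use v v' sym[of v x] sym[of v' x'] in auto)
    then show ?thesis by blast
  next
    case not_hyp: False
    show ?thesis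
    proof (cases "\<exists>u. T (T u - u) - (T u - u) \<noteq> 0 \<and>
        T (T (T u - u) - (T u - u)) - (T (T u - u) - (T u - u)) = 0")
      case True
      then obtain u0 where u0: "T (T u0 - u0) - (T u0 - u0) \<noteq> 0"
          "T (T (T u0 - u0) - (T u0 - u0)) - (T (T u0 - u0) - (T u0 - u0)) = 0"
        by blast
      obtain u0' where u0': "T' (T' u0' - u0') - (T' u0' - u0') \<noteq> 0"
          "T' (T' (T' u0' - u0') - (T' u0' - u0')) - (T' (T' u0' - u0') - (T' u0' - u0')) = 0"
        using par[OF lin eq u0] by blast
      obtain u y w where T_chain: "T u = u + y" "T y = y + w" "T w = w"
        and gram: "B u u = 0" "B u y = 1 / 2" "B u w = 1" "B y y = - 1" "B y w = 0" "B w w = 0"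
        using T.parabolic_chain[OF u0] by blast
      obtain u' y' w' where T'_chain: "T' u' = u' + y'" "T' y' = y' + w'" "T' w' = w'"
        and gram': "B u' u' = 0" "B u' y' = 1 / 2" "B u' w' = 1" "B y' y' = - 1" "B y' w' = 0"
          "B w' w' = 0"
        using T'.parabolic_chain[OF u0'] by blast
      let ?X = "{(u, u'), (y, y'), (w, w')}"
      have "partial_intertwiner T T' (span ?X)"
      proof (rule partial_intertwiner_span[OF lin])
        have X: "(u, u') + (y, y') \<in> span ?X" "(y, y') + (w, w') \<in> span ?X" "(w, w') \<in> span ?X"
          by (intro span_add span_base; simp)+
        fix a b assume "(a, b) \<in> ?X"
        then show "(T a, T' b) \<in> span ?X" using X T_chain T'_chain by auto
      next
        have "(u, u') + (w, w') \<in> span ?X" by (intro span_add span_base) auto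
        then show "\<exists>p\<in>span ?X. B (fst p) (fst p) > 0"
          using gram sym[of w u] by (intro bexI[of _ "(u, u') + (w, w')"]) auto
      qed (use gram gram' sym[of y u] sym[of w u] sym[of w y]
             sym[of y' u'] sym[of w' u'] sym[of w' y'] in auto)
      then show ?thesis by blast
    next
      case not_par: False
      obtain v where v: "T v = v" "B v v > 0"
        using T.trichotomy[OF T(2)] not_hyp not_par by metis
      have "\<not> (\<exists>x l. T' x = l *\<^sub>R x \<and> x \<noteq> 0 \<and> l\<^sup>2 \<noteq> 1)"
        using hyp[OF lin(2,1) eq[symmetric]] not_hyp by metis
      moreover have "\<not> (\<exists>u. T' (T' u - u) - (T' u - u) \<noteq> 0 \<and>
          T' (T' (T' u - u) - (T' u - u)) - (T' (T' u - u) - (T' u - u)) = 0)"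
        using par[OF lin(2,1) eq[symmetric]] not_par by metis
      ultimately obtain v' where v': "T' v' = v'" "B v' v' > 0"
        using T'.trichotomy[OF T'(2)] by metis
      \<comment> \<open>Rescales \<open>v'\<close> to the same square as \<open>v\<close>.\<close>
      define c where "c = sqrt (B v v / B v' v')"
      have c: "c * (c * B v' v') = B v v"
        using v v' unfolding c_def mult.assoc[symmetric] by simp
      have "partial_intertwiner T T' (span {(v, c *\<^sub>R v')})"
        by (rule partial_intertwiner_span[OF lin])
           (use v v' c in \<open>auto intro: span_base intro!: bexI[of _ "(v, c *\<^sub>R v')"]\<close>)
      then show ?thesis by blast
    qed
  qed
qed

end

section \<open>From a quadratic form of signature (1,n) to conjugacy of isometries\<close>

lemma polar_form_self:
  assumes "quadratic_form Q"
  shows "polar_form Q x x = Q x"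
proof -
  have "Q (2 *\<^sub>R x) = 2\<^sup>2 * Q x" using assms unfolding quadratic_form_def by blast
  then show ?thesis by (simp add: polar_form_def scaleR_2)
qed

text \<open>The reference vector is the normalised positive basis vector \<open>p\<close>. A vector
  orthogonal to \<open>p\<close> has zero coordinate along it, so only basis vectors with negative
  \<open>Q\<close> contribute to its square.\<close>

lemma lorentz_form_of_signature:
  fixes Q :: "'v::euclidean_space \<Rightarrow> real"
  assumes Q: "quadratic_form Q" and sig: "has_signature Q 1 n"
  shows "\<exists>e. lorentz_form (polar_form Q) e"
proof -
  let ?B = "polar_form Q"
  have bil: "bilinear ?B" using Q by (simp add: quadratic_form_def)
  have sym: "?B x y = ?B y x" for x y by (simp add: polar_form_def add.commute)
  obtain P N where PN: "finite P" "finite N" "card P = 1" "independent (P \<union> N)"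
    "span (P \<union> N) = UNIV" "\<forall>x\<in>P \<union> N. \<forall>y\<in>P \<union> N. x \<noteq> y \<longrightarrow> ?B x y = 0"
    "\<forall>x\<in>P. Q x > 0" "\<forall>x\<in>N. Q x < 0"
    using sig unfolding has_signature_def by (elim exE conjE) (rule that; assumption)
  obtain p where p: "P = {p}" using PN(3) by (auto simp: card_1_singleton_iff)
  define S where "S = P \<union> N"
  have fin: "finite S" using PN by (simp add: S_def)
  have neg: "?B v v < 0" if vp: "?B v p = 0" and v: "v \<noteq> 0" for v
  proof (rule ccontr)
    assume n: "\<not> ?B v v < 0"
    define r where "r = representation S v"
    have v_eq: "v = (\<Sum>b\<in>S. r b *\<^sub>R b)"
      unfolding r_def using PN fin
      by (intro real_vector.sum_representation_eq[symmetric]) (auto simp: S_def)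
    have Bv: "?B v b = r b * Q b" if b: "b \<in> S" for b
    proof -
      have lin: "linear (\<lambda>x. ?B x b)" using bil by (simp add: bilinear_def)
      have "?B v b = (\<Sum>a\<in>S. r a * ?B a b)"
        by (subst v_eq) (simp only: linear_sum[OF lin] linear_cmul[OF lin] real_scaleR_def)
      also have "\<dots> = (\<Sum>a\<in>S. if a = b then r b * Q b else 0)"
        using PN(6) b by (intro sum.cong) (auto simp: S_def polar_form_self[OF Q])
      also have "\<dots> = r b * Q b" using b fin by simp
      finally show ?thesis .
    qed
    have lin: "linear (?B v)" using bil by (simp add: bilinear_def)
    have "?B v v = (\<Sum>b\<in>S. r b * ?B v b)"
      by (subst (2) v_eq) (simp only: linear_sum[OF lin] linear_cmul[OF lin] real_scaleR_def)
    also have "\<dots> = (\<Sum>b\<in>S. (r b)\<^sup>2 * Q b)"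
      by (intro sum.cong refl) (simp add: Bv power2_eq_square)
    finally have Bvv: "?B v v = (\<Sum>b\<in>S. (r b)\<^sup>2 * Q b)" .
    have "r p = 0" using Bv[of p] vp PN(7) p by (auto simp: S_def)
    have nonpos: "(r b)\<^sup>2 * Q b \<le> 0" if "b \<in> S" for b
    proof (cases "b = p")
      case False
      then have "Q b < 0" using that p PN(8) by (auto simp: S_def)
      then show ?thesis by (simp add: mult_nonneg_nonpos)
    qed (simp add: \<open>r p = 0\<close>)
    then have "?B v v = 0" using n Bvv sum_nonpos[of S "\<lambda>b. (r b)\<^sup>2 * Q b"] by simp
    then have "\<forall>b\<in>S. (r b)\<^sup>2 * Q b = 0"
      using sum_nonneg_eq_0_iff[OF fin, of "\<lambda>b. - ((r b)\<^sup>2 * Q b)"] nonpos Bvv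
      by (simp add: sum_negf)
    then have "r b = 0" if "b \<in> S" for b
      using that PN(7,8) by (fastforce simp: S_def)
    then have "v = 0" using v_eq by simp
    then show False using v by simp
  qed
  have Qp: "Q p > 0" using PN(7) p by blast
  let ?e = "(1 / sqrt (Q p)) *\<^sub>R p"
  have scale: "?B x (c *\<^sub>R y) = c * ?B x y" "?B (c *\<^sub>R x) y = c * ?B x y" for x y c
    using bilinear_rmul[OF bil] bilinear_lmul[OF bil] by simp_all
  have "lorentz_form ?B ?e"
  proof unfold_locales
    show "?B ?e ?e = 1" using Qp unfolding scale polar_form_self[OF Q, of p] by simp
    show "?B x x < 0" if "?B x ?e = 0" "x \<noteq> 0" for x
      using neg[of x] that Qp by (simp add: scale)
  qed (use bil sym in auto)
  then show ?thesis ..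
qed

theorem theorem1p2:
  fixes n :: nat
    and Q :: "'v::euclidean_space \<Rightarrow> real"
    and H :: "'v set"
    and T T' :: "'v \<Rightarrow> 'v"
  assumes "n \<ge> 1"
    and "DIM('v) = n + 1"
    and "quadratic_form Q"
    and "has_signature Q 1 n"
    and "H \<in> components (hyperboloid Q)"
    and "T \<in> hyperbolic_isometries Q H"
    and "T' \<in> hyperbolic_isometries Q H"
    and "operator_char_poly T = operator_char_poly T'"
    and "operator_min_poly T = operator_min_poly T'"
  shows "conjugate_in (hyperbolic_isometries Q H) T T'"
proof -
  define B where "B = polar_form Q"
  have Q: "Q v = B v v" for v by (simp add: B_def polar_form_self[OF assms(3)])
  have H: "H \<in> components {v. B v v = 1}" using assms(5) by (simp add: hyperboloid_def Q)
  obtain e where e: "e \<in> H" using in_components_nonempty[OF H] by blast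
  then have "B e e = 1" using in_components_subset[OF H] by blast
  then interpret lorentz_form B e
    using lorentz_form_of_signature[OF assms(3,4)] lorentz_form.lorentz_form_timelike
    unfolding B_def by blast
  \<comment> \<open>Since \<open>e\<close> lies in \<open>H\<close>, preserving \<open>H\<close>
    puts \<open>S e\<close> on the same sheet, which is expressed by the sign of its pairing with
    \<open>e\<close>.\<close>
  have iso: "lorentz_isometry B e S" and pos: "B (S e) e > 0"
    if S: "S \<in> hyperbolic_isometries Q H" for S
  proof -
    have S': "linear S" "\<And>v. Q (S v) = Q v" "S e \<in> H"
      using S e by (auto simp: hyperbolic_isometries_def orthogonal_group_def)
    then show "lorentz_isometry B e S"
      by (intro lorentz_isometry.intro lorentz_isometry_axioms.intro lorentz_form_axioms)
         (simp_all add: B_def polar_form_def S'(2) flip: linear_add[OF S'(1)])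
    show "B (S e) e > 0" using component_hyperboloid[OF H e] S'(3) by blast
  qed
  obtain G where "partial_intertwiner T T' G"
    using partial_intertwiner_exists[OF iso[OF assms(6)] pos[OF assms(6)] iso[OF assms(7)]
        pos[OF assms(7)] assms(9)] by blast
  from partial_intertwiner_total[OF iso[OF assms(6)] iso[OF assms(7)] assms(8) this]
  obtain h where h: "linear h" "\<And>x y. B (h x) (h y) = B x y" "\<And>x. h (T x) = T' (h x)" by blast
  \<comment> \<open>\<open>h\<close> may exchange the two sheets; its negative still intertwines
    \<open>T\<close> and \<open>T'\<close>, so the sign is chosen to keep \<open>e\<close> on its
    sheet.\<close>
  define g where "g x = sgn (B (h e) e) *\<^sub>R h x" for x
  \<comment> \<open>A vector of square 1 such as \<open>h e\<close> cannot be orthogonal to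
    \<open>e\<close>, so the sign is not zero.\<close>
  have "B (h e) e \<noteq> 0"
    using neg[of "h e"] h(2)[of e e] unit by force
  then have sgn: "sgn (B (h e) e) * sgn (B (h e) e) = 1" by (simp add: sgn_if)
  interpret g: lorentz_isometry B e g
  proof (intro lorentz_isometry.intro lorentz_isometry_axioms.intro lorentz_form_axioms)
    show "linear g"
      by (rule linearI)
         (simp_all add: g_def linear_add[OF h(1)] linear_cmul[OF h(1)] scaleR_right_distrib)
    show "B (g x) (g y) = B x y" for x y
      using sgn by (simp add: g_def h(2) mult.assoc[symmetric])
  qed
  have "B (g e) e > 0"
    using \<open>B (h e) e \<noteq> 0\<close> by (simp add: g_def sgn_if)
  then have "g ` H = H" using g.preserves_component[OF _ H e] by blast
  then have "g \<in> hyperbolic_isometries Q H"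
    using g.linear_T g.inj_T g.surj_T
    by (simp add: hyperbolic_isometries_def orthogonal_group_def Q g.isometry bij_def)
  moreover have "T' = g \<circ> T \<circ> inv_into UNIV g"
  proof
    fix x
    have "linear T'" using iso[OF assms(7)] by (rule lorentz_isometry.linear_T)
    then have "g (T y) = T' (g y)" for y by (simp add: g_def h(3) linear_cmul)
    then show "T' x = (g \<circ> T \<circ> inv_into UNIV g) x" by (simp add: surj_f_inv_f[OF g.surj_T])
  qed
  ultimately show ?thesis unfolding conjugate_in_def by blast
qed

end
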